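(* The relations $FCO$, $CO$ (on $\mathbb{M}$) and $\equiv^i_c$ (on $\mathcal{S}_m$) are analytic, and $FCO$ is Borel reducible to $\equiv^i_c$; that is, there is a Borel map $\varphi:\mathbb{M}\to\mathcal{S}_m$ such that $FCO=(\varphi\times\varphi)^{-1}(\equiv^i_c)$.
   Context: $\mathcal{H}(2^\omega)$ is the group of homeomorphisms of $2^\omega$, equipped with the Polish topology whose basic open sets are $\{f\in\mathcal{H}(2^\omega)\mid\forall 1\leq i\leq n\ f[U_i]=V_i\}$ with $n\in\omega$ and $U_i,V_i$ clopen subsets of $2^\omega$. $\mathbb{M}\subseteq\mathcal{H}(2^\omega)$ is the Polish space of minimal homeomorphisms of $2^\omega$ (those $f$ for which $\{f^i(x)\mid i\in\mathbb{Z}\}$ is dense in $2^\omega$ for each $x\in 2^\omega$). For $f,g\in\mathbb{M}$: $f,g$ are conjugate (relation $CO$) if there is $\varphi\in\mathcal{H}(2^\omega)$ with $\varphi\circ f=g\circ\varphi$; they are flip-conjugate (relation $FCO$) if there is $\varphi\in\mathcal{H}(2^\omega)$ with $\varphi\circ f=g\circ\varphi$ or $\varphi\circ f=g^{-1}\circ\varphi$. $\mathcal{K}(2^\omega\times 2^\omega)$ is the space of compact subsets of $2^\omega\times 2^\omega$ with the Vietoris topology. The continuous chromatic number $\chi_c(X,R)$ is the least cardinal $\kappa\leq\aleph_0$ for which there is a continuous map $c:X\to\kappa$ ($\kappa$ discrete) with $c(x)\neq c(y)$ whenever $(x,y)\in R$, if it exists, and $2^{\aleph_0}$ otherwise. Let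 $$\mathcal{S}_m=\{(2^\omega,K)\in\{2^\omega\}\times\mathcal{K}(2^\omega\times 2^\omega)\mid K\cap\Delta(2^\omega)=\emptyset\ \wedge\ 2\leq\chi_c(2^\omega,K)\leq 3\},$$ with the subspace topology (a Polish space), where $\Delta(2^\omega)$ is the diagonal. $(2^\omega,K)\preceq^i_c(2^\omega,K')$ means that there is an injective continuous $\varphi:2^\omega\to 2^\omega$ with $K\subseteq(\varphi\times\varphi)^{-1}(K')$, and $\equiv^i_c$ is the associated equivalence relation $\preceq^i_c\cap(\preceq^i_c)^{-1}$ on $\mathcal{S}_m$. *)

theory Defs
  imports "HOL-Analysis.Analysis"
begin

section \<open>Descriptive set theory\<close>

definition polish_space :: "'a topology \<Rightarrow> bool" where
  "polish_space T \<longleftrightarrow> completely_metrizable_space T \<and> second_countable T"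

text \<open>A set is analytic if it is a continuous image of a Polish space. Every Polish space has at
  most continuum many points, so it has a homeomorphic copy whose points are functions of type
  \<^typ>\<open>nat \<Rightarrow> nat\<close>; letting \<open>P\<close> range over all Polish topologies on
  sets of such functions is therefore no restriction. The empty set is analytic, as the topology
  of \<open>P\<close> may live on the empty set.\<close>

definition analytic_in :: "'a topology \<Rightarrow> 'a set \<Rightarrow> bool" where
  "analytic_in X A \<longleftrightarrow>
     (\<exists>(P :: (nat \<Rightarrow> nat) topology) f.
        polish_space P \<and> continuous_map P X f \<and> f ` topspace P = A)"

definition borel_of :: "'a topology \<Rightarrow> 'a measure" where
  "borel_of X = sigma (topspace X) {U. openin X U}"

definition borel_map :: "'a topology \<Rightarrow> 'b topology \<Rightarrow> ('a \<Rightarrow> 'b) \<Rightarrow> bool" where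
  "borel_map X Y f \<longleftrightarrow> f \<in> borel_of X \<rightarrow>\<^sub>M borel_of Y"

section \<open>Homeomorphisms of the Cantor space\<close>

text \<open>The type carries the product topology of the discrete space \<^typ>\<open>bool\<close>.\<close>

type_synonym cantor = "nat \<Rightarrow> bool"

definition homeos :: "(cantor \<Rightarrow> cantor) set" where
  "homeos = {f. homeomorphic_map euclidean euclidean f}"

text \<open>Finite intersections of the generating sets are the basic open sets
  \<open>{f. \<forall>i. f ` U\<^sub>i = V\<^sub>i}\<close>; the choice \<open>U = V = UNIV\<close> yields the whole
  of \<^term>\<open>homeos\<close>.\<close>

definition homeo_topology :: "(cantor \<Rightarrow> cantor) topology" where
  "homeo_topology = topology_generated_by
     {{f \<in> homeos. f ` U = V} | U V. open U \<and> closed U \<and> open V \<and> closed V}"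

definition int_iterate :: "('a \<Rightarrow> 'a) \<Rightarrow> int \<Rightarrow> 'a \<Rightarrow> 'a" where
  "int_iterate f i = (if i \<ge> 0 then f ^^ nat i else inv f ^^ nat (- i))"

definition minimal_homeos :: "(cantor \<Rightarrow> cantor) set" where
  "minimal_homeos = {f \<in> homeos. \<forall>x. closure {int_iterate f i x | i. True} = UNIV}"

definition minimal_topology :: "(cantor \<Rightarrow> cantor) topology" where
  "minimal_topology = subtopology homeo_topology minimal_homeos"

definition CO :: "((cantor \<Rightarrow> cantor) \<times> (cantor \<Rightarrow> cantor)) set" where
  "CO = {(f, g). f \<in> minimal_homeos \<and> g \<in> minimal_homeos \<and>
           (\<exists>\<phi>\<in>homeos. \<phi> \<circ> f = g \<circ> \<phi>)}"

definition FCO :: "((cantor \<Rightarrow> cantor) \<times> (cantor \<Rightarrow> cantor)) set" where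
  "FCO = {(f, g). f \<in> minimal_homeos \<and> g \<in> minimal_homeos \<and>
            (\<exists>\<phi>\<in>homeos. \<phi> \<circ> f = g \<circ> \<phi> \<or> \<phi> \<circ> f = inv g \<circ> \<phi>)}"

section \<open>Continuous chromatic numbers\<close>

text \<open>The possible values of the continuous chromatic number: \<open>Countable n\<close> is a finite
  cardinal, \<open>Countable \<infinity>\<close> is \<open>\<aleph>\<^sub>0\<close>, and
  \<open>Continuum\<close> is \<open>2\<close> to the power \<open>\<aleph>\<^sub>0\<close>.\<close>

datatype chromatic_value = Countable enat | Continuum

instantiation chromatic_value :: linorder
begin

fun less_eq_chromatic_value :: "chromatic_value \<Rightarrow> chromatic_value \<Rightarrow> bool" where
  "Countable k \<le> Countable l \<longleftrightarrow> k \<le> l"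
| "_ \<le> Continuum \<longleftrightarrow> True"
| "Continuum \<le> Countable _ \<longleftrightarrow> False"

definition less_chromatic_value :: "chromatic_value \<Rightarrow> chromatic_value \<Rightarrow> bool" where
  "x < y \<longleftrightarrow> x \<le> y \<and> \<not> y \<le> (x :: chromatic_value)"

instance
proof
  fix x y z :: chromatic_value
  show "x < y \<longleftrightarrow> x \<le> y \<and> \<not> y \<le> x"
    by (rule less_chromatic_value_def)
  show "x \<le> x"
    by (cases x) auto
  show "x \<le> z" if "x \<le> y" "y \<le> z"
    using that by (cases x; cases y; cases z) auto
  show "x = y" if "x \<le> y" "y \<le> x"
    using that by (cases x; cases y) auto
  show "x \<le> y \<or> y \<le> x"
    by (cases x; cases y) auto
qed

end

text \<open>The cardinal \<open>\<kappa> \<le> \<aleph>\<^sub>0\<close> is the discrete space of the natural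
  numbers below \<open>\<kappa>\<close>.\<close>

definition continuous_colouring ::
  "'a::topological_space set \<Rightarrow> ('a \<times> 'a) set \<Rightarrow> enat \<Rightarrow> ('a \<Rightarrow> nat) \<Rightarrow> bool" where
  "continuous_colouring X R \<kappa> c \<longleftrightarrow>
     continuous_map (top_of_set X) (discrete_topology {n. enat n < \<kappa>}) c \<and>
     (\<forall>(x, y)\<in>R. c x \<noteq> c y)"

definition continuous_chromatic_number ::
  "'a::topological_space set \<Rightarrow> ('a \<times> 'a) set \<Rightarrow> chromatic_value" where
  "continuous_chromatic_number X R =
     (if \<exists>\<kappa> c. continuous_colouring X R \<kappa> c
      then Countable (LEAST \<kappa>. \<exists>c. continuous_colouring X R \<kappa> c)
      else Continuum)"

section \<open>The space of relations\<close>

definition vietoris_topology :: "'a::topological_space set topology" where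
  "vietoris_topology = topology_generated_by
     ({{K. compact K \<and> K \<subseteq> U} | U. open U} \<union>
      {{K. compact K \<and> K \<inter> U \<noteq> {}} | U. open U})"

definition S_m :: "(cantor set \<times> (cantor \<times> cantor) set) set" where
  "S_m = {(X, K). X = UNIV \<and> compact K \<and> K \<inter> Id = {} \<and>
            Countable 2 \<le> continuous_chromatic_number X K \<and>
            continuous_chromatic_number X K \<le> Countable 3}"

definition S_m_topology :: "(cantor set \<times> (cantor \<times> cantor) set) topology" where
  "S_m_topology =
     subtopology (prod_topology (discrete_topology {UNIV}) vietoris_topology) S_m"

definition inj_cont_le ::
  "'a::topological_space set \<times> ('a \<times> 'a) set \<Rightarrow>
   'b::topological_space set \<times> ('b \<times> 'b) set \<Rightarrow> bool" (infix "\<preceq>ic" 50) where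
  "XR \<preceq>ic YS \<longleftrightarrow>
     (case (XR, YS) of ((X, R), (Y, S)) \<Rightarrow>
        \<exists>\<phi>. continuous_on X \<phi> \<and> \<phi> \<in> X \<rightarrow> Y \<and> inj_on \<phi> X \<and>
            R \<subseteq> map_prod \<phi> \<phi> -` S)"

definition equiv_ic ::
  "((cantor set \<times> (cantor \<times> cantor) set) \<times> (cantor set \<times> (cantor \<times> cantor) set)) set" where
  "equiv_ic = {(G, H). G \<in> S_m \<and> H \<in> S_m \<and> G \<preceq>ic H \<and> H \<preceq>ic G}"

end

theory Submission
  imports Defs
begin

text \<open>
  The reduction sends a minimal homeomorphism \<open>f\<close> to the symmetrised graph
  \<open>{(x, y). y = f x \<or> x = f y}\<close>. It lies in \<^const>\<open>S_m\<close>: a minimal \<open>f\<close> has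
  no fixed point, so finitely many clopen sets disjoint from their images cover the space, and
  this finite colouring can be brought down to three colours greedily, because a point has only
  the two neighbours \<open>f x\<close> and \<open>inv f x\<close> (\<open>three_colouring\<close>). A flip conjugacy from
  \<open>f\<close> to \<open>g\<close> is an isomorphism of the graphs. Conversely, let \<open>\<phi>\<close> be an injective continuous
  homomorphism. At each point \<open>x\<close> it either respects the direction of the edge from \<open>x\<close> to
  \<open>f x\<close> or reverses it, exactly one of the two since \<open>g\<close> has no point of period two, and
  injectivity forbids a change of direction along an orbit. The two alternatives therefore split
  the space into two invariant closed sets, one of which is empty by minimality of \<open>f\<close>. The
  range of \<open>\<phi>\<close> is then closed and \<open>g\<close>-invariant, hence everything by minimality of \<open>g\<close>
  (\<open>injective_homomorphism_flip_conjugacy\<close>). The map is even continuous: evaluation of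
  homeomorphisms is jointly continuous, and taking ranges turns a jointly continuous family over a
  compact space into a continuous map for the Vietoris topology
  (\<open>continuous_map_vietoris_topology_range\<close>).

  For analyticity, everything is parametrised by one point \<open>b\<close> of the Baire space. A continuous
  self-map of the Cantor space is a sequence of clopen sets, the preimages of the coordinate
  conditions; as there are only countably many clopen sets, \<open>b\<close> codes a sequence of such maps
  \<open>coded_map b i\<close>. This coding is jointly continuous in \<open>b\<close> and the argument, and it reaches every
  sequence of continuous maps. By compactness of the Cantor space (the tube lemma), quantifiers
  over points preserve openness and closedness of conditions on \<open>b\<close>, so that
  being a pair of mutually inverse maps, conjugating one coded map to another, and
  being a homomorphism of coded relations are closed conditions, having a three-colouring is open,
  and minimality and injectivity are \<open>G\<^sub>\<delta>\<close>. A \<open>G\<^sub>\<delta>\<close> subset of the Baire space is Polish, and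
  each of the three relations is the continuous image of such a set. Compact relations are coded
  too, since every nonempty compact subset of the square of the Cantor space is the range of a pair
  of continuous maps (\<open>compact_pairs_cantor_image\<close>).
\<close>

section \<open>Compactness and discrete-valued maps\<close>

lemma compact_cantor: "compact (UNIV :: cantor set)"
proof -
  have "compact_space (product_topology (\<lambda>i::nat. euclidean :: bool topology) UNIV)"
    unfolding compact_space_product_topology
    by (auto simp: compact_space_def intro: finite_imp_compact)
  then show ?thesis
    by (simp add: euclidean_product_topology compact_space_def)
qed

lemma closed_if_compact_cantor:
  assumes "compact (K :: cantor set)"
  shows "closed K"
proof -
  have "Hausdorff_space (euclidean :: bool topology)"
    unfolding Hausdorff_space_def
  proof (intro allI impI, elim conjE)
    fix x y :: bool
    assume "x \<noteq> y"
    from hausdorff[OF this]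
    show "\<exists>U V. openin euclidean U \<and> openin euclidean V \<and> x \<in> U \<and> y \<in> V \<and> disjnt U V"
      by (simp add: disjnt_def)
  qed
  then have "Hausdorff_space (product_topology (\<lambda>i::nat. euclidean :: bool topology) UNIV)"
    by (simp add: Hausdorff_space_product_topology)
  then have "Hausdorff_space (euclidean :: cantor topology)"
    by (simp add: euclidean_product_topology)
  then show ?thesis
    using compactin_imp_closedin[of euclidean K] assms by simp
qed

lemma continuous_on_discrete_iff:
  fixes p :: "'a::topological_space \<Rightarrow> 'b::discrete_topology"
  shows "continuous_on UNIV p \<longleftrightarrow> (\<forall>v. open {z. p z = v})"
proof
  assume "continuous_on UNIV p"
  then have "open (p -` {v})" for v
    by (intro open_vimage) (auto simp: open_discrete)
  then show "\<forall>v. open {z. p z = v}" by (simp add: vimage_def)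
next
  assume *: "\<forall>v. open {z. p z = v}"
  have "p -` B = (\<Union>v\<in>B. {z. p z = v})" for B by auto
  then have "open (p -` B)" for B using * by auto
  then show "continuous_on UNIV p" by (simp add: continuous_on_open_vimage)
qed

text \<open>A relation between two discrete-valued continuous maps is automatically clopen. This replaces
  the continuity of Boolean and case-defined functions throughout.\<close>

lemma open_Collect_discrete2:
  fixes p :: "'a::topological_space \<Rightarrow> 'b::discrete_topology" and q :: "'a \<Rightarrow> 'c::discrete_topology"
  assumes "continuous_on UNIV p" "continuous_on UNIV q"
  shows "open {z. R (p z) (q z)}"
proof -
  have "{z. R (p z) (q z)} = (\<Union>a. \<Union>b\<in>{b. R a b}. {z. p z = a} \<inter> {z. q z = b})" by auto
  also have "open \<dots>"
    using assms by (intro open_UN open_Int ballI) (simp_all add: continuous_on_discrete_iff)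
  finally show ?thesis .
qed

lemma continuous_on_discrete2:
  fixes p :: "'a::topological_space \<Rightarrow> 'b::discrete_topology" and q :: "'a \<Rightarrow> 'c::discrete_topology"
    and F :: "'b \<Rightarrow> 'c \<Rightarrow> 'd::discrete_topology"
  assumes "continuous_on UNIV p" "continuous_on UNIV q"
  shows "continuous_on UNIV (\<lambda>z. F (p z) (q z))"
  unfolding continuous_on_discrete_iff using open_Collect_discrete2[OF assms, of "\<lambda>a b. F a b = _"]
  by simp

text \<open>Two points of the Cantor space differ exactly when some coordinate differs, and each coordinate
  takes values in a discrete space.\<close>

lemma closed_Collect_eq_cantor:
  fixes f g :: "'a::topological_space \<Rightarrow> cantor"
  assumes "continuous_on UNIV f" "continuous_on UNIV g"
  shows "closed {z. f z = g z}"
proof -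
  have "open {z. f z n \<noteq> g z n}" for n
    using assms by (intro open_Collect_discrete2) (auto intro: continuous_on_product_then_coordinatewise)
  then have "open (\<Union>n. {z. f z n \<noteq> g z n})" by blast
  moreover have "- {z. f z = g z} = (\<Union>n. {z. f z n \<noteq> g z n})" by (auto simp: fun_eq_iff)
  ultimately show ?thesis by (simp add: closed_def)
qed

text \<open>The tube lemma read as a rule about quantifiers: a universal quantifier over a compact set
  preserves openness. The existential dual below preserves closedness.\<close>

lemma openin_Collect_ball_compact:
  assumes "compactin Y C" and "openin (prod_topology X Y) {z \<in> topspace X \<times> topspace Y. P (fst z) (snd z)}"
  shows "openin X {t \<in> topspace X. \<forall>x\<in>C. P t x}"
proof (subst openin_subopen, intro ballI)
  fix t assume t: "t \<in> {t \<in> topspace X. \<forall>x\<in>C. P t x}"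
  have "C \<subseteq> topspace Y" using assms(1) by (rule compactin_subset_topspace)
  with t have "{t} \<times> C \<subseteq> {z \<in> topspace X \<times> topspace Y. P (fst z) (snd z)}" by auto
  from tube_lemma_right[OF assms(2,1) _ this] t obtain U V where
    "openin X U" "t \<in> U" "C \<subseteq> V" and UV: "U \<times> V \<subseteq> {z \<in> topspace X \<times> topspace Y. P (fst z) (snd z)}"
    by auto
  have "P s x" if "s \<in> U" "x \<in> C" for s x
    using UV \<open>C \<subseteq> V\<close> that by fastforce
  then have "U \<subseteq> {t \<in> topspace X. \<forall>x\<in>C. P t x}"
    using openin_subset[OF \<open>openin X U\<close>] by blast
  then show "\<exists>T. openin X T \<and> t \<in> T \<and> T \<subseteq> {t \<in> topspace X. \<forall>x\<in>C. P t x}"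
    using \<open>openin X U\<close> \<open>t \<in> U\<close> by blast
qed

lemma open_Collect_ball_compact:
  assumes "compact K" and "open {z. P (fst z) (snd z)}"
  shows "open {b. \<forall>x\<in>K. P b x}"
  using openin_Collect_ball_compact[of euclidean K euclidean P] assms by simp

lemma closed_Collect_bex_compact:
  assumes "compact K" and "closed {z. P (fst z) (snd z)}"
  shows "closed {b. \<exists>x\<in>K. P b x}"
proof -
  have "open {b. \<forall>x\<in>K. \<not> P b x}"
    using assms(1) assms(2)[unfolded closed_def, folded Collect_neg_eq]
    by (rule open_Collect_ball_compact)
  moreover have "- {b. \<exists>x\<in>K. P b x} = {b. \<forall>x\<in>K. \<not> P b x}" by auto
  ultimately show ?thesis by (simp only: closed_def)
qed

section \<open>Clopen subsets of the Cantor space\<close>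

definition cylinder :: "nat \<Rightarrow> cantor \<Rightarrow> cantor set" where
  "cylinder n x = {y. \<forall>i<n. y i = x i}"

lemma clopen_cylinder: "open (cylinder n x)" "closed (cylinder n x)"
proof -
  have eq: "cylinder n x = (\<Inter>i\<in>{..<n}. (\<lambda>y. y i) -` {x i})"
    by (auto simp: cylinder_def)
  show "open (cylinder n x)" unfolding eq
    by (intro open_INT ballI open_vimage) (auto simp: open_discrete)
  show "closed (cylinder n x)" unfolding eq
    by (intro closed_INT ballI closed_vimage) (auto simp: closed_def open_discrete)
qed

lemma cylinder_in_open:
  assumes "open U" "x \<in> U"
  shows "\<exists>n. cylinder n x \<subseteq> U"
proof -
  from assms obtain X where X: "x \<in> Pi\<^sub>E UNIV X" "finite {i. X i \<noteq> UNIV}" "Pi\<^sub>E UNIV X \<subseteq> U"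
    unfolding open_fun_def using product_topology_open_contains_basis[of "\<lambda>i. euclidean" UNIV U x]
    by auto
  obtain n where n: "\<And>i. X i \<noteq> UNIV \<Longrightarrow> i < n"
    using X(2) finite_nat_set_iff_bounded[of "{i. X i \<noteq> UNIV}"] by auto
  have "y i \<in> X i" if "y \<in> cylinder n x" for y i
    using that n[of i] X(1) by (cases "X i = UNIV") (auto simp: cylinder_def PiE_iff)
  then have "cylinder n x \<subseteq> U" using X(3) by (auto simp: PiE_iff)
  then show ?thesis ..
qed

text \<open>By compactness a clopen set is a finite union of cylinders, and a cylinder is given by a length
  and a finite set of positions carrying the value \<open>True\<close>.\<close>

lemma countable_clopen: "countable {U :: cantor set. open U \<and> closed U}"
proof -
  define B where "B = range (\<lambda>(n, k). cylinder n (\<lambda>i. i \<in> set_decode k))"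
  have B: "cylinder n x \<in> B" for n x
  proof -
    have "cylinder n x = cylinder n (\<lambda>i. i \<in> set_decode (set_encode {i. i < n \<and> x i}))"
      by (simp add: cylinder_def set_encode_inverse)
    also have "\<dots> \<in> B"
      unfolding B_def by (rule range_eqI[of _ _ "(n, set_encode {i. i < n \<and> x i})"]) simp
    finally show ?thesis .
  qed
  have "countable B" unfolding B_def by (rule countable_image) simp
  have "U \<in> Union ` {F. finite F \<and> F \<subseteq> B}" if "open U" "closed U" for U
  proof -
    have "compact U" using compact_Int_closed[OF compact_cantor that(2)] by simp
    obtain n where n: "\<And>x. x \<in> U \<Longrightarrow> cylinder (n x) x \<subseteq> U"
      using cylinder_in_open[OF \<open>open U\<close>] by metis
    have cover: "U \<subseteq> (\<Union>x\<in>U. cylinder (n x) x)" by (auto simp: cylinder_def)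
    obtain D where D: "D \<subseteq> U" "finite D" "U \<subseteq> (\<Union>x\<in>D. cylinder (n x) x)"
      by (rule compactE_image[OF \<open>compact U\<close> _ cover]) (use clopen_cylinder in blast)+
    have "U = \<Union> ((\<lambda>x. cylinder (n x) x) ` D)"
    proof
      show "U \<subseteq> \<Union> ((\<lambda>x. cylinder (n x) x) ` D)" by (rule D(3))
      show "\<Union> ((\<lambda>x. cylinder (n x) x) ` D) \<subseteq> U" using n D(1) by (intro UN_least) auto
    qed
    moreover have "(\<lambda>x. cylinder (n x) x) ` D \<in> {F. finite F \<and> F \<subseteq> B}"
      using D(2) B by auto
    ultimately show ?thesis by (rule image_eqI)
  qed
  then have "{U :: cantor set. open U \<and> closed U} \<subseteq> Union ` {F. finite F \<and> F \<subseteq> B}" by blast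
  then show ?thesis
    by (rule countable_subset) (intro countable_image countable_Collect_finite_subset \<open>countable B\<close>)
qed

section \<open>Continuity into the hyperspace and the homeomorphism group\<close>

lemma topspace_vietoris_topology [simp]: "topspace vietoris_topology = {K. compact K}"
proof -
  have "{K. compact K} \<in> {{K. compact K \<and> K \<subseteq> U} | U. open (U :: 'a set)}"
    by (rule CollectI, rule exI[of _ UNIV]) simp
  then show ?thesis
    unfolding vietoris_topology_def topology_generated_by_topspace by auto
qed

text \<open>For the upper half of the Vietoris topology, \<open>range (h t) \<subseteq> U\<close> is a universal quantifier over a
  compact space and is open in \<open>t\<close> by the tube lemma. For the lower half, meeting an open set is an
  existential quantifier, a union of open conditions.\<close>

lemma continuous_map_vietoris_topology_range:
  fixes h :: "'a \<Rightarrow> 'c::topological_space \<Rightarrow> 'd::topological_space"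
  assumes C: "compact (UNIV :: 'c set)"
    and h: "continuous_map (prod_topology X euclidean) euclidean (\<lambda>z. h (fst z) (snd z))"
  shows "continuous_map X vietoris_topology (\<lambda>t. range (h t))"
proof -
  have sect: "continuous_map X euclidean (\<lambda>t. h t x)" for x
  proof -
    have "continuous_map X (prod_topology X euclidean) (\<lambda>t. (t, x))"
      by (simp add: continuous_map_pairwise comp_def)
    from continuous_map_compose[OF this h] show ?thesis by (simp add: comp_def)
  qed
  have cpt: "compact (range (h t))" if "t \<in> topspace X" for t
  proof -
    have "continuous_map euclidean (prod_topology X euclidean) (\<lambda>x. (t, x))"
      using that by (simp add: continuous_map_pairwise comp_def)
    from continuous_map_compose[OF this h] have "continuous_on UNIV (h t)" by (simp add: comp_def)
    then show ?thesis using C by (rule compact_continuous_image)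
  qed
  have upper: "openin X {t \<in> topspace X. range (h t) \<subseteq> U}" if "open U" for U
  proof -
    have "openin (prod_topology X euclidean) {z \<in> topspace X \<times> topspace euclidean. h (fst z) (snd z) \<in> U}"
      using openin_continuous_map_preimage[OF h, of U] that by simp
    from openin_Collect_ball_compact[OF _ this, of UNIV] C
    show ?thesis by (simp add: image_subset_iff)
  qed
  have lower: "openin X {t \<in> topspace X. range (h t) \<inter> U \<noteq> {}}" if "open U" for U
  proof -
    have "{t \<in> topspace X. range (h t) \<inter> U \<noteq> {}} = (\<Union>x. {t \<in> topspace X. h t x \<in> U})" by auto
    also have "openin X \<dots>"
      by (rule openin_Union) (use openin_continuous_map_preimage[OF sect] that in auto)
    finally show ?thesis .
  qed
  show ?thesis
    unfolding vietoris_topology_def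
  proof (rule continuous_on_generated_topo)
    fix W :: "'d set set"
    assume "W \<in> {{K. compact K \<and> K \<subseteq> U} | U. open U} \<union> {{K. compact K \<and> K \<inter> U \<noteq> {}} | U. open U}"
    then consider U where "open U" "W = {K. compact K \<and> K \<subseteq> U}"
      | U where "open U" "W = {K. compact K \<and> K \<inter> U \<noteq> {}}" by blast
    then show "openin X ((\<lambda>t. range (h t)) -` W \<inter> topspace X)"
    proof cases
      case 1
      have "(\<lambda>t. range (h t)) -` W \<inter> topspace X = {t \<in> topspace X. range (h t) \<subseteq> U}"
        unfolding 1(2) using cpt by blast
      then show ?thesis using upper[OF 1(1)] by simp
    next
      case 2
      have "(\<lambda>t. range (h t)) -` W \<inter> topspace X = {t \<in> topspace X. range (h t) \<inter> U \<noteq> {}}"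
        unfolding 2(2) using cpt by blast
      then show ?thesis using lower[OF 2(1)] by simp
    qed
  next
    have "(\<lambda>t. range (h t)) ` topspace X \<subseteq> {K. compact K}" using cpt by auto
    also have "\<dots> \<subseteq> \<Union> {{K. compact K \<and> K \<subseteq> U} | U. open U}"
      by (rule Union_upper, rule CollectI, rule exI[of _ UNIV]) simp
    finally show "(\<lambda>t. range (h t)) ` topspace X
        \<subseteq> \<Union> ({{K. compact K \<and> K \<subseteq> U} | U. open U} \<union> {{K. compact K \<and> K \<inter> U \<noteq> {}} | U. open U})"
      unfolding Union_Un_distrib by (rule le_supI1)
  qed
qed

lemma homeosI:
  assumes "continuous_on UNIV f" "continuous_on UNIV g" "\<And>x. g (f x) = x" "\<And>x. f (g x) = x"
  shows "f \<in> homeos" "inv f = g"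
proof -
  show "f \<in> homeos"
    unfolding homeos_def homeomorphic_map_maps homeomorphic_maps_def using assms by auto
  show "inv f = g"
    using assms(3,4) by (intro inv_unique_comp) auto
qed

lemma homeosD:
  assumes "f \<in> homeos"
  shows "continuous_on UNIV f" "continuous_on UNIV (inv f)" "inv f \<in> homeos" "bij f"
proof -
  obtain g where "continuous_on UNIV f" "continuous_on UNIV g" "\<And>x. g (f x) = x" "\<And>x. f (g x) = x"
    using assms unfolding homeos_def homeomorphic_map_maps homeomorphic_maps_def by auto
  moreover from this have "inv f = g" by (intro homeosI(2))
  ultimately show "continuous_on UNIV f" "continuous_on UNIV (inv f)" "inv f \<in> homeos" "bij f"
    by (simp_all add: homeosI(1)[of g f] bij_def inj_on_def surj_def) metis
qed

lemma topspace_homeo_topology [simp]: "topspace homeo_topology = homeos"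
proof -
  have "{f \<in> homeos. f ` UNIV = UNIV} = homeos"
    using homeosD(4) by (auto simp: bij_def)
  then have "homeos \<in> {{f \<in> homeos. f ` U = V} | U V. open U \<and> closed U \<and> open V \<and> closed V}"
    by (intro CollectI exI[of _ UNIV]) simp
  then show ?thesis unfolding homeo_topology_def topology_generated_by_topspace by blast
qed

lemma minimal_homeosD:
  assumes "f \<in> minimal_homeos"
  shows "f \<in> homeos" "closure {int_iterate f i x | i. True} = UNIV"
  using assms by (auto simp: minimal_homeos_def)

lemma topspace_minimal_topology [simp]: "topspace minimal_topology = minimal_homeos"
  unfolding minimal_topology_def using minimal_homeosD(1) by auto

text \<open>Given \<open>f x \<in> W\<close>, choose a cylinder \<open>V\<close> around \<open>f x\<close> inside \<open>W\<close> and let \<open>U\<close> be its preimage. All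
  homeomorphisms \<open>g\<close> with \<open>g ` U = V\<close>, a subbasic open set, map all points of \<open>U\<close> into \<open>W\<close>.\<close>

lemma continuous_map_evaluation:
  "continuous_map (prod_topology homeo_topology euclidean) euclidean (\<lambda>z. fst z (snd z))"
proof -
  have "openin (prod_topology homeo_topology euclidean) {z \<in> homeos \<times> UNIV. fst z (snd z) \<in> W}"
    if "open W" for W :: "cantor set"
    unfolding openin_prod_topology_alt
  proof (intro allI impI)
    fix f x assume "(f, x) \<in> {z \<in> homeos \<times> UNIV. fst z (snd z) \<in> W}"
    then have f: "f \<in> homeos" "f x \<in> W" by auto
    obtain n where n: "cylinder n (f x) \<subseteq> W" using cylinder_in_open[OF \<open>open W\<close> f(2)] by blast
    define V where "V = cylinder n (f x)"
    define U where "U = f -` V"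
    define N where "N = {g \<in> homeos. g ` U = V}"
    have "open V" "closed V" by (simp_all add: V_def clopen_cylinder)
    then have "open U" "closed U"
      unfolding U_def using homeosD(1)[OF f(1)] by (auto intro: open_vimage closed_vimage)
    have "openin homeo_topology N"
      unfolding homeo_topology_def N_def
      by (rule topology_generated_by_Basis) (use \<open>open V\<close> \<open>closed V\<close> \<open>open U\<close> \<open>closed U\<close> in blast)
    moreover have "f \<in> N" using f(1) homeosD(4)[OF f(1)] by (simp add: N_def U_def bij_is_surj surj_image_vimage_eq)
    moreover have "x \<in> U" by (simp add: U_def V_def cylinder_def)
    moreover have "N \<times> U \<subseteq> {z \<in> homeos \<times> UNIV. fst z (snd z) \<in> W}"
      using n by (auto simp: N_def V_def)
    ultimately show "\<exists>N U. openin homeo_topology N \<and> openin euclidean U \<and> f \<in> N \<and> x \<in> U \<and>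
        N \<times> U \<subseteq> {z \<in> homeos \<times> UNIV. fst z (snd z) \<in> W}"
      using \<open>open U\<close> by (intro exI[of _ N] exI[of _ U]) simp
  qed
  then show ?thesis by (simp add: continuous_map_def)
qed

text \<open>For bijections, \<open>F t ` U = V\<close> says that \<open>x \<in> U \<longleftrightarrow> F t x \<in> V\<close> for all \<open>x\<close>, which is
  an open condition on \<open>(t, x)\<close> for clopen \<open>U\<close> and \<open>V\<close>, so the tube lemma applies.\<close>

lemma continuous_map_homeo_topology:
  assumes F: "\<And>t. t \<in> topspace X \<Longrightarrow> F t \<in> homeos"
    and joint: "continuous_map (prod_topology X euclidean) euclidean (\<lambda>z. F (fst z) (snd z))"
  shows "continuous_map X homeo_topology F"
  unfolding homeo_topology_def
proof (rule continuous_on_generated_topo)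
  fix W assume "W \<in> {{f \<in> homeos. f ` U = V} | U V. open U \<and> closed U \<and> open V \<and> closed V}"
  then obtain U V where UV: "open U" "closed U" "open V" "closed V" and W: "W = {f \<in> homeos. f ` U = V}"
    by blast
  let ?E = "prod_topology X (euclidean :: cantor topology)"
  have pre: "openin ?E {z \<in> topspace ?E. F (fst z) (snd z) \<in> A}" if "open A" for A
    using openin_continuous_map_preimage[OF joint, of A] that by simp
  have "{z \<in> topspace X \<times> topspace euclidean. snd z \<in> U \<longleftrightarrow> F (fst z) (snd z) \<in> V}
      = (topspace X \<times> U \<inter> {z \<in> topspace ?E. F (fst z) (snd z) \<in> V})
        \<union> (topspace X \<times> (- U) \<inter> {z \<in> topspace ?E. F (fst z) (snd z) \<in> - V})"
    by auto
  also have "openin ?E \<dots>"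
    using UV by (intro openin_Un openin_Int pre) (auto simp: openin_prod_Times_iff)
  finally have "openin X {t \<in> topspace X. \<forall>x\<in>UNIV. x \<in> U \<longleftrightarrow> F t x \<in> V}"
    by (intro openin_Collect_ball_compact[of euclidean UNIV]) (use compact_cantor in auto)
  moreover have "F -` W \<inter> topspace X = {t \<in> topspace X. \<forall>x\<in>UNIV. x \<in> U \<longleftrightarrow> F t x \<in> V}"
  proof -
    have "F t ` U = V \<longleftrightarrow> (\<forall>x. x \<in> U \<longleftrightarrow> F t x \<in> V)" if "t \<in> topspace X" for t
    proof -
      have "bij (F t)" using F that homeosD(4) by blast
      then have "F t ` U = V \<longleftrightarrow> U = F t -` V"
        by (metis bij_is_inj bij_is_surj inj_vimage_image_eq surj_image_vimage_eq)
      then show ?thesis by auto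
    qed
    then show ?thesis unfolding W using F by auto
  qed
  ultimately show "openin X (F -` W \<inter> topspace X)" by simp
next
  show "F ` topspace X \<subseteq> \<Union> {{f \<in> homeos. f ` U = V} | U V. open U \<and> closed U \<and> open V \<and> closed V}"
    using F topspace_homeo_topology unfolding homeo_topology_def topology_generated_by_topspace by blast
qed

section \<open>Polish subspaces of the Baire space\<close>

lemma completely_metrizable_baire: "completely_metrizable_space (euclidean :: (nat \<Rightarrow> nat) topology)"
proof -
  have "(euclidean :: nat topology) = discrete_topology UNIV"
    by (simp add: topology_eq open_discrete)
  then have "completely_metrizable_space (euclidean :: nat topology)"
    by (simp add: completely_metrizable_space_discrete_topology)
  then show ?thesis
    unfolding euclidean_product_topology[symmetric] completely_metrizable_space_product_topology by simp
qed

lemma polish_space_gdelta: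
  assumes "gdelta_in euclidean (P :: (nat \<Rightarrow> nat) set)"
  shows "polish_space (top_of_set P)"
proof -
  obtain B :: "(nat \<Rightarrow> nat) set set" where B: "countable B" "topological_basis B"
    using ex_countable_basis by blast
  have "second_countable (euclidean :: (nat \<Rightarrow> nat) topology)"
    unfolding second_countable_def
    using B(1) topological_basis_open[OF B(2)] topological_basisE[OF B(2)]
    by (intro exI[of _ B]) (simp, metis)
  then show ?thesis
    unfolding polish_space_def
    using completely_metrizable_space_gdelta_in[OF completely_metrizable_baire assms]
      second_countable_subtopology by blast
qed

text \<open>A \<open>G\<^sub>\<delta>\<close> subset of a Polish space is Polish, so conditions on codes may be countable
  intersections of open sets.\<close>

lemma analytic_in_gdelta_image:
  assumes "gdelta_in euclidean (P :: (nat \<Rightarrow> nat) set)" "continuous_map (top_of_set P) X F" "F ` P = A"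
  shows "analytic_in X A"
  unfolding analytic_in_def
  by (rule exI[of _ "top_of_set P"], rule exI[of _ F]) (simp add: assms polish_space_gdelta)

lemma gdelta_closed: "closed (P :: (nat \<Rightarrow> nat) set) \<Longrightarrow> gdelta_in euclidean P"
  by (intro closed_imp_gdelta_in completely_metrizable_imp_metrizable_space completely_metrizable_baire) simp

lemma gdelta_open: "open P \<Longrightarrow> gdelta_in euclidean P"
  by (intro open_imp_gdelta_in) simp

section \<open>Codes for sequences of continuous maps\<close>

definition clopen_enum :: "nat \<Rightarrow> cantor set" where
  "clopen_enum = from_nat_into {U. open U \<and> closed U}"

lemma range_clopen_enum: "range clopen_enum = {U. open U \<and> closed U}"
  unfolding clopen_enum_def by (rule range_from_nat_into) (use countable_clopen in auto)

lemma clopen_clopen_enum: "open (clopen_enum k)" "closed (clopen_enum k)"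
  using range_clopen_enum by blast+

text \<open>The section of \<open>b\<close> at \<open>i\<close> lists clopen sets \<open>C\<^sub>0, C\<^sub>1, \<dots>\<close>, and
  the coded map sends \<open>x\<close> to its sequence of memberships in them. Every \<open>b\<close> is a code.\<close>

definition coded_map :: "(nat \<Rightarrow> nat) \<Rightarrow> nat \<Rightarrow> cantor \<Rightarrow> cantor" where
  "coded_map b i x = (\<lambda>n. x \<in> clopen_enum (b (prod_encode (i, n))))"

text \<open>Membership of \<open>x\<close> in the clopen set numbered \<open>k\<close> is locally constant in \<open>x\<close>, and the number
  \<open>k\<close> is a single coordinate of the code.\<close>

lemma continuous_on_coded_map_pair: "continuous_on UNIV (\<lambda>z. coded_map (fst z) i (snd z))"
proof (rule continuous_on_coordinatewise_then_product)
  fix n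
  let ?m = "prod_encode (i, n)"
  have 1: "open {b :: nat \<Rightarrow> nat. b ?m = k}" for k
    using iffD1[OF continuous_on_discrete_iff, rule_format,
        OF continuous_on_product_coordinates[of ?m, where 'b = nat]] by simp
  have eq: "{z. coded_map (fst z) i (snd z) n = v}
      = (\<Union>k. {b. b ?m = k} \<times> {x. (x \<in> clopen_enum k) = v})" for v
    by (auto simp: coded_map_def)
  have 2: "open {x. (x \<in> clopen_enum k) = v}" for k v
  proof -
    have "{x. (x \<in> clopen_enum k) = v} = (if v then clopen_enum k else - clopen_enum k)" by auto
    then show ?thesis using clopen_clopen_enum[of k] by (simp add: closed_def)
  qed
  show "continuous_on UNIV (\<lambda>z. coded_map (fst z) i (snd z) n)"
    unfolding continuous_on_discrete_iff eq by (intro allI open_UN ballI open_Times 1 2)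
qed

lemma continuous_on_coded_map:
  assumes "continuous_on S f" "continuous_on S g"
  shows "continuous_on S (\<lambda>z. coded_map (f z) i (g z))"
  using continuous_on_compose2[OF continuous_on_coded_map_pair continuous_on_Pair[OF assms]] by simp

text \<open>The preimages of the coordinate conditions under a continuous map are clopen, hence listed in
  the enumeration.\<close>

lemma coded_map_universal:
  assumes "\<And>i. continuous_on UNIV (H i)"
  obtains b where "coded_map b = H"
proof -
  have "{x. H i x n} \<in> range clopen_enum" for i n
  proof -
    have "continuous_on UNIV (\<lambda>x. H i x n)"
      by (rule continuous_on_product_then_coordinatewise[OF assms])
    then have o: "open {x. H i x n = v}" for v by (simp add: continuous_on_discrete_iff)
    have "- {x. H i x n} = {x. H i x n = False}" by auto
    then have "closed {x. H i x n}" using o[of False] by (simp only: closed_def)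
    then show ?thesis using o[of True] by (simp add: range_clopen_enum)
  qed
  then have "\<exists>k. {x. H i x n} = clopen_enum k" for i n by blast
  then obtain k where k: "\<And>i n. {x. H i x n} = clopen_enum (k i n)" by metis
  have "coded_map (\<lambda>m. case prod_decode m of (i, n) \<Rightarrow> k i n) = H"
    by (intro ext) (simp add: coded_map_def flip: k)
  then show thesis by (rule that)
qed

section \<open>Conjugacy and flip conjugacy are analytic\<close>

text \<open>Being a homeomorphism is not a closed condition on a single map; carrying a code of
  the inverse along makes it one.\<close>

definition inverse_codes :: "nat \<Rightarrow> nat \<Rightarrow> (nat \<Rightarrow> nat) set" where
  "inverse_codes i j = {b. \<forall>x. coded_map b j (coded_map b i x) = x \<and> coded_map b i (coded_map b j x) = x}"

lemma continuous_on_coded_map_section: "continuous_on UNIV (coded_map b i)"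
  using continuous_on_coded_map[OF continuous_on_const continuous_on_id] .

lemma closed_inverse_codes: "closed (inverse_codes i j)"
proof -
  have *: "continuous_on UNIV (\<lambda>b. coded_map b k (coded_map b l x))" for k l x
    by (intro continuous_on_coded_map continuous_on_id continuous_on_const)
  show ?thesis unfolding inverse_codes_def
    by (intro closed_Collect_all closed_Collect_conj closed_Collect_eq_cantor * continuous_on_const)
qed

lemma inverse_codesD:
  assumes "b \<in> inverse_codes i j"
  shows "coded_map b i \<in> homeos" "inv (coded_map b i) = coded_map b j"
  using homeosI[OF continuous_on_coded_map_section[of b i] continuous_on_coded_map_section[of b j]] assms
  by (auto simp: inverse_codes_def)

lemma inverse_codesI:
  assumes "coded_map b i \<in> homeos" "coded_map b j = inv (coded_map b i)"
  shows "b \<in> inverse_codes i j"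
  using homeosD(4)[OF assms(1)] unfolding inverse_codes_def
  by (simp add: assms(2) bij_is_inj bij_is_surj surj_f_inv_f)

text \<open>Density of an orbit only has to be tested on the countably many nonempty clopen sets.\<close>

lemma minimal_homeos_iff:
  "f \<in> minimal_homeos \<longleftrightarrow> f \<in> homeos \<and>
    (\<forall>u. clopen_enum u \<noteq> {} \<longrightarrow> (\<forall>x. \<exists>k. int_iterate f k x \<in> clopen_enum u))"
proof -
  have *: "closure A = UNIV \<longleftrightarrow> (\<forall>u. clopen_enum u \<noteq> {} \<longrightarrow> A \<inter> clopen_enum u \<noteq> {})" for A :: "cantor set"
  proof
    assume "closure A = UNIV"
    then show "\<forall>u. clopen_enum u \<noteq> {} \<longrightarrow> A \<inter> clopen_enum u \<noteq> {}"
      using open_Int_closure_eq_empty[OF clopen_clopen_enum(1), of _ A] by (auto simp: Int_commute)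
  next
    assume A: "\<forall>u. clopen_enum u \<noteq> {} \<longrightarrow> A \<inter> clopen_enum u \<noteq> {}"
    have "- closure A = {}"
    proof (rule ccontr)
      assume "- closure A \<noteq> {}"
      then obtain x where "x \<in> - closure A" by blast
      then obtain n where n: "cylinder n x \<subseteq> - closure A"
        using cylinder_in_open[of "- closure A" x] by auto
      obtain u where u: "cylinder n x = clopen_enum u"
        using clopen_cylinder[of n x] range_clopen_enum by blast
      have "x \<in> clopen_enum u" unfolding u[symmetric] by (simp add: cylinder_def)
      then have "A \<inter> clopen_enum u \<noteq> {}" using A by blast
      then show False using n u closure_subset[of A] by blast
    qed
    then show "closure A = UNIV" by blast
  qed
  show ?thesis unfolding minimal_homeos_def * by blast
qed

definition minimal_codes :: "nat \<Rightarrow> nat \<Rightarrow> (nat \<Rightarrow> nat) set" where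
  "minimal_codes i j = {b \<in> inverse_codes i j. coded_map b i \<in> minimal_homeos}"

lemma continuous_on_coded_map_funpow: "continuous_on UNIV (\<lambda>z. (coded_map (fst z) i ^^ m) (snd z))"
proof (induction m)
  case 0
  then show ?case by (simp add: continuous_on_snd)
next
  case (Suc m)
  have "continuous_on UNIV (\<lambda>z. coded_map (fst z) i ((coded_map (fst z) i ^^ m) (snd z)))"
    by (intro continuous_on_coded_map Suc continuous_on_fst continuous_on_id)
  then show ?case by simp
qed

text \<open>For each nonempty clopen set the condition that every orbit visits it is open, by compactness;
  minimality is the intersection of these countably many conditions. The inverse occurring in
  negative iterates is available as the second coded map.\<close>

lemma gdelta_minimal_codes: "gdelta_in euclidean (minimal_codes i j)"
proof -
  define it where "it b k = (if k \<ge> 0 then coded_map b i ^^ nat k else coded_map b j ^^ nat (- k))" for b and k :: int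
  define D where "D u = {b. \<forall>x\<in>UNIV. \<exists>k. it b k x \<in> clopen_enum u}" for u
  have "continuous_on UNIV (\<lambda>z. it (fst z) k (snd z))" for k
    unfolding it_def by (cases "k \<ge> 0") (simp_all add: continuous_on_coded_map_funpow)
  then have "open ((\<lambda>z. it (fst z) k (snd z)) -` clopen_enum u)" for k u
    by (rule open_vimage[OF clopen_clopen_enum(1)])
  then have "open {z. it (fst z) k (snd z) \<in> clopen_enum u}" for k u
    by (simp only: vimage_def)
  then have "open {z. \<exists>k. it (fst z) k (snd z) \<in> clopen_enum u}" for u
    by (intro open_Collect_ex)
  then have D: "open (D u)" for u
    unfolding D_def by (intro open_Collect_ball_compact compact_cantor)
  have it: "it b k = int_iterate (coded_map b i) k" if "b \<in> inverse_codes i j" for b k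
    using inverse_codesD(2)[OF that] by (simp add: it_def int_iterate_def)
  have "minimal_codes i j = inverse_codes i j \<inter> (\<Inter>u\<in>{u. clopen_enum u \<noteq> {}}. D u)"
  proof (rule set_eqI)
    fix b
    show "b \<in> minimal_codes i j \<longleftrightarrow> b \<in> inverse_codes i j \<inter> (\<Inter>u\<in>{u. clopen_enum u \<noteq> {}}. D u)"
      by (cases "b \<in> inverse_codes i j")
        (simp_all add: minimal_codes_def minimal_homeos_iff D_def inverse_codesD(1) it)
  qed
  moreover have "{u. clopen_enum u \<noteq> {}} \<noteq> {}"
  proof -
    have "UNIV \<in> range clopen_enum" by (simp add: range_clopen_enum)
    then obtain u where "clopen_enum u = UNIV" by (metis rangeE)
    then have "u \<in> {u. clopen_enum u \<noteq> {}}" by simp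
    then show ?thesis by blast
  qed
  then have "gdelta_in euclidean (\<Inter>u\<in>{u. clopen_enum u \<noteq> {}}. D u)"
    by (intro gdelta_in_Inter) (auto intro: gdelta_open D)
  ultimately show ?thesis
    using gdelta_in_Int gdelta_closed[OF closed_inverse_codes] by metis
qed

lemma continuous_map_codes:
  fixes h :: "'a::topological_space \<Rightarrow> 'b::topological_space \<Rightarrow> 'c::topological_space"
  assumes "continuous_on UNIV (\<lambda>z. h (fst z) (snd z))"
  shows "continuous_map (prod_topology (top_of_set P) euclidean) euclidean (\<lambda>z. h (fst z) (snd z))"
proof -
  have "prod_topology (top_of_set P) (euclidean :: 'b topology) = top_of_set (P \<times> UNIV)"
    using prod_topology_subtopology(1)[of euclidean P euclidean] by simp
  then show ?thesis by (simp add: continuous_on_subset[OF assms])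
qed

lemma continuous_map_minimal_codes:
  assumes "P \<subseteq> minimal_codes i j"
  shows "continuous_map (top_of_set P) minimal_topology (\<lambda>b. coded_map b i)"
  unfolding minimal_topology_def continuous_map_in_subtopology
proof
  show "continuous_map (top_of_set P) homeo_topology (\<lambda>b. coded_map b i)"
    using assms by (intro continuous_map_homeo_topology continuous_map_codes continuous_on_coded_map_pair)
      (auto simp: minimal_codes_def minimal_homeosD)
  show "(\<lambda>b. coded_map b i) \<in> topspace (top_of_set P) \<rightarrow> minimal_homeos"
    using assms by (auto simp: minimal_codes_def)
qed

text \<open>Both conjugacy relations quantify over a homeomorphism \<open>\<phi>\<close> that satisfies an equation with
  \<open>f\<close>, \<open>g\<close> and their inverses. Codes of \<open>f\<close>, \<open>inv f\<close>, \<open>g\<close>, \<open>inv g\<close>, \<open>\<phi>\<close>, \<open>inv \<phi>\<close> sit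
  at positions 0 to 5, and the equation becomes a closed set \<open>E\<close> of codes.\<close>

lemma analytic_conjugacy:
  assumes E: "closed E"
    and Q: "\<And>b. b \<in> minimal_codes 0 1 \<inter> minimal_codes 2 3 \<Longrightarrow> b \<in> E \<longleftrightarrow> Q (coded_map b 0) (coded_map b 2) (coded_map b 4)"
  shows "analytic_in (prod_topology minimal_topology minimal_topology)
    {(f, g). f \<in> minimal_homeos \<and> g \<in> minimal_homeos \<and> (\<exists>\<phi>\<in>homeos. Q f g \<phi>)}"
proof (rule analytic_in_gdelta_image)
  let ?M = "minimal_codes 0 1 \<inter> minimal_codes 2 3"
  let ?P = "?M \<inter> (inverse_codes 4 5 \<inter> E)"
  show "gdelta_in euclidean ?P"
    by (intro gdelta_in_Int gdelta_minimal_codes gdelta_closed closed_inverse_codes E)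
  show "continuous_map (top_of_set ?P) (prod_topology minimal_topology minimal_topology) (\<lambda>b. (coded_map b 0, coded_map b 2))"
    unfolding continuous_map_pairwise comp_def fst_conv snd_conv
    by (intro conjI continuous_map_minimal_codes[of _ 0 1] continuous_map_minimal_codes[of _ 2 3]) auto
  show "(\<lambda>b. (coded_map b 0, coded_map b 2)) ` ?P
      = {(f, g). f \<in> minimal_homeos \<and> g \<in> minimal_homeos \<and> (\<exists>\<phi>\<in>homeos. Q f g \<phi>)}" (is "?L = ?R")
  proof
    show "?L \<subseteq> ?R"
      using Q inverse_codesD(1) by (auto simp: minimal_codes_def)
    show "?R \<subseteq> ?L"
    proof clarify
      fix f g \<phi> assume fg: "f \<in> minimal_homeos" "g \<in> minimal_homeos" and \<phi>: "\<phi> \<in> homeos" "Q f g \<phi>"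
      define H where "H i = (if i = 0 then f else if i = 1 then inv f else if i = 2 then g
        else if i = 3 then inv g else if i = 4 then \<phi> else inv \<phi>)" for i :: nat
      have "continuous_on UNIV (H i)" for i
        using minimal_homeosD(1)[OF fg(1)] minimal_homeosD(1)[OF fg(2)] \<phi>(1)
        by (simp add: H_def homeosD(1,2))
      then obtain b where b: "coded_map b = H" using coded_map_universal[of H] by blast
      have H: "H 0 = f" "H (Suc 0) = inv f" "H 2 = g" "H 3 = inv g" "H 4 = \<phi>" "H 5 = inv \<phi>"
        by (simp_all add: H_def)
      have "b \<in> ?M"
        unfolding minimal_codes_def using fg
        by (auto intro!: inverse_codesI simp: b H minimal_homeosD)
      moreover have "b \<in> inverse_codes 4 5"
        using \<phi> by (auto intro!: inverse_codesI simp: b H)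
      moreover have "b \<in> E" using Q[OF \<open>b \<in> ?M\<close>] \<phi>(2) by (simp add: b H)
      ultimately show "(f, g) \<in> ?L"
        by (intro image_eqI[of _ _ b]) (auto simp: b H)
    qed
  qed
qed

lemma closed_coded_equation:
  "closed {b. \<forall>x. coded_map b i (coded_map b j x) = coded_map b k (coded_map b l x)}"
  by (intro closed_Collect_all closed_Collect_eq_cantor continuous_on_coded_map continuous_on_id continuous_on_const)

lemma analytic_CO: "analytic_in (prod_topology minimal_topology minimal_topology) CO"
  unfolding CO_def
  by (rule analytic_conjugacy[OF closed_coded_equation[of 4 0 2 4]]) (simp add: fun_eq_iff)

lemma analytic_FCO: "analytic_in (prod_topology minimal_topology minimal_topology) FCO"
  unfolding FCO_def
proof (rule analytic_conjugacy)
  show "closed ({b. \<forall>x. coded_map b 4 (coded_map b 0 x) = coded_map b 2 (coded_map b 4 x)}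
      \<union> {b. \<forall>x. coded_map b 4 (coded_map b 0 x) = coded_map b 3 (coded_map b 4 x)})"
    by (intro closed_Un closed_coded_equation)
  fix b assume "b \<in> minimal_codes 0 1 \<inter> minimal_codes 2 3"
  then have "inv (coded_map b 2) = coded_map b 3" by (auto simp: minimal_codes_def inverse_codesD)
  then show "b \<in> {b. \<forall>x. coded_map b 4 (coded_map b 0 x) = coded_map b 2 (coded_map b 4 x)}
      \<union> {b. \<forall>x. coded_map b 4 (coded_map b 0 x) = coded_map b 3 (coded_map b 4 x)} \<longleftrightarrow>
    coded_map b 4 \<circ> coded_map b 0 = coded_map b 2 \<circ> coded_map b 4 \<or> coded_map b 4 \<circ> coded_map b 0 = inv (coded_map b 2) \<circ> coded_map b 4"
    by (simp add: fun_eq_iff)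
qed

section \<open>Relations of continuous chromatic number two or three\<close>

lemma continuous_colouring_iff:
  "continuous_colouring UNIV R \<kappa> c \<longleftrightarrow>
    continuous_on UNIV c \<and> (\<forall>x. enat (c x) < \<kappa>) \<and> (\<forall>(x, y)\<in>R. c x \<noteq> c y)"
proof -
  have "continuous_map euclidean (discrete_topology {n. enat n < \<kappa>}) c \<longleftrightarrow>
      continuous_on UNIV c \<and> (\<forall>x. enat (c x) < \<kappa>)" (is "?L \<longleftrightarrow> ?R")
  proof
    assume L: ?L
    then have "enat (c x) < \<kappa>" for x
      using continuous_map_image_subset_topspace by fastforce
    moreover have "open {x. c x = v}" for v
    proof (cases "enat v < \<kappa>")
      case True
      then show ?thesis using openin_continuous_map_preimage[OF L, of "{v}"] by simp
    next
      case False
      then have "{x. c x = v} = {}" using \<open>\<And>x. enat (c x) < \<kappa>\<close> by blast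
      then show ?thesis by (simp only: open_empty)
    qed
    ultimately show ?R by (simp add: continuous_on_discrete_iff)
  next
    assume R: ?R
    then have "open {x. c x \<in> V}" for V
      using open_vimage[OF open_discrete, of c V] by (simp add: vimage_def)
    with R show ?L by (simp add: continuous_map_def)
  qed
  then show ?thesis by (simp add: continuous_colouring_def)
qed

lemma continuous_chromatic_number_le_iff:
  "continuous_chromatic_number UNIV R \<le> Countable \<kappa> \<longleftrightarrow> (\<exists>c. continuous_colouring UNIV R \<kappa> c)"
proof
  assume le: "continuous_chromatic_number UNIV R \<le> Countable \<kappa>"
  then have ex: "\<exists>\<mu> c. continuous_colouring UNIV R \<mu> c"
    by (auto simp: continuous_chromatic_number_def split: if_splits)
  define \<mu> where "\<mu> = (LEAST \<mu>. \<exists>c. continuous_colouring UNIV R \<mu> c)"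
  obtain c where c: "continuous_colouring UNIV R \<mu> c"
    unfolding \<mu>_def using LeastI_ex[OF ex] by blast
  have "\<mu> \<le> \<kappa>" using le ex by (simp add: continuous_chromatic_number_def \<mu>_def)
  with c have "continuous_colouring UNIV R \<kappa> c"
    unfolding continuous_colouring_iff by (meson order_less_le_trans)
  then show "\<exists>c. continuous_colouring UNIV R \<kappa> c" by (rule exI[of _ c])
next
  assume ex: "\<exists>c. continuous_colouring UNIV R \<kappa> c"
  then have "(LEAST \<mu>. \<exists>c. continuous_colouring UNIV R \<mu> c) \<le> \<kappa>" by (rule Least_le)
  with ex show "continuous_chromatic_number UNIV R \<le> Countable \<kappa>"
    by (auto simp: continuous_chromatic_number_def)
qed

text \<open>A relation with a continuous colouring by one colour is empty, and every proper colouring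
  keeps the relation off the diagonal. Hence the chromatic bounds say that the relation is
  nonempty and has a continuous proper colouring by three colours.\<close>

lemma S_m_iff:
  "(X, K) \<in> S_m \<longleftrightarrow> X = UNIV \<and> compact K \<and> K \<noteq> {} \<and>
    (\<exists>c :: cantor \<Rightarrow> nat. continuous_on UNIV c \<and> (\<forall>x. c x < 3) \<and> (\<forall>(x, y)\<in>K. c x \<noteq> c y))"
proof -
  have two: "Countable 2 \<le> v \<longleftrightarrow> \<not> v \<le> Countable 1" for v
  proof (cases v)
    case (Countable e)
    have "2 \<le> e \<longleftrightarrow> \<not> e \<le> 1"
      by (cases e) (simp_all add: numeral_eq_enat one_enat_def, arith)
    with Countable show ?thesis by simp
  qed simp
  have "(\<exists>c. continuous_colouring UNIV K 1 c) \<longleftrightarrow> K = {}" for K :: "(cantor \<times> cantor) set"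
  proof
    assume "\<exists>c. continuous_colouring UNIV K 1 c"
    then obtain c where c: "continuous_colouring UNIV K 1 c" ..
    then have "c x = 0" for x by (simp add: continuous_colouring_iff one_enat_def)
    with c show "K = {}" by (auto simp: continuous_colouring_iff)
  next
    assume "K = {}"
    then show "\<exists>c. continuous_colouring UNIV K 1 c"
      by (intro exI[of _ "\<lambda>_. 0"]) (simp add: continuous_colouring_iff one_enat_def)
  qed
  then have lower: "Countable 2 \<le> continuous_chromatic_number UNIV K \<longleftrightarrow> K \<noteq> {}"
    by (simp add: two continuous_chromatic_number_le_iff)
  have upper: "continuous_chromatic_number UNIV K \<le> Countable 3 \<longleftrightarrow>
    (\<exists>c :: cantor \<Rightarrow> nat. continuous_on UNIV c \<and> (\<forall>x. c x < 3) \<and> (\<forall>(x, y)\<in>K. c x \<noteq> c y))"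
    by (simp add: continuous_chromatic_number_le_iff continuous_colouring_iff numeral_eq_enat)
  have "K \<inter> Id = {}" if "\<forall>(x, y)\<in>K. c x \<noteq> c y" for c :: "cantor \<Rightarrow> nat"
    using that by auto
  then show ?thesis
    unfolding S_m_def using lower upper by auto
qed

lemma continuous_map_S_m:
  assumes "\<And>t. t \<in> topspace X \<Longrightarrow> (UNIV, k t) \<in> S_m" "continuous_map X vietoris_topology k"
  shows "continuous_map X S_m_topology (\<lambda>t. (UNIV, k t))"
  unfolding S_m_topology_def continuous_map_in_subtopology continuous_map_pairwise comp_def fst_conv snd_conv
  using assms by auto

section \<open>Compact sets as continuous images of the Cantor space\<close>

text \<open>A retraction onto a closed set \<open>K\<close>, computed digit by digit: copy the next digit of \<open>x\<close> if the
  prefix obtained so far, extended by this digit, is still the prefix of a point of \<open>K\<close>, and take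
  the other digit otherwise. Only the first \<open>n\<close> values of \<open>retract_prefix K x n\<close> matter.\<close>

primrec retract_prefix :: "cantor set \<Rightarrow> cantor \<Rightarrow> nat \<Rightarrow> cantor" where
  "retract_prefix K x 0 = (\<lambda>_. False)"
| "retract_prefix K x (Suc n) = (retract_prefix K x n)
     (n := if \<exists>y\<in>K. (\<forall>i<n. y i = retract_prefix K x n i) \<and> y n = x n then x n else \<not> x n)"

definition retract :: "cantor set \<Rightarrow> cantor \<Rightarrow> cantor" where
  "retract K x n = retract_prefix K x (Suc n) n"

lemma retract_prefix_eq: "i < n \<Longrightarrow> retract_prefix K x n i = retract K x i"
proof (induction n)
  case (Suc n)
  show ?case
  proof (cases "i = n")
    case False
    with Suc have "retract_prefix K x n i = retract K x i" by simp
    with False show ?thesis by simp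
  qed (simp only: retract_def)
qed simp

text \<open>The prefixes never leave the tree of prefixes of points of \<open>K\<close>: if the copied digit leads out of
  it, the other digit is the one taken by all points of \<open>K\<close> through the current prefix.\<close>

lemma retract_prefix_in:
  assumes "K \<noteq> {}"
  shows "\<exists>y\<in>K. \<forall>i<n. y i = retract_prefix K x n i"
proof (induction n)
  case (Suc n)
  then obtain y where y: "y \<in> K" "\<forall>i<n. y i = retract_prefix K x n i" by blast
  show ?case
  proof (cases "\<exists>y\<in>K. (\<forall>i<n. y i = retract_prefix K x n i) \<and> y n = x n")
    case True
    then obtain z where "z \<in> K" "\<forall>i<n. z i = retract_prefix K x n i" "z n = x n" by blast
    with True show ?thesis by (intro bexI[of _ z]) (auto simp: less_Suc_eq)
  next
    case False
    with y have "y n = (\<not> x n)" by blast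
    with False y show ?thesis by (intro bexI[of _ y]) (auto simp: less_Suc_eq)
  qed
qed (use assms in auto)

lemma retract_prefix_id: "x \<in> K \<Longrightarrow> i < n \<Longrightarrow> retract_prefix K x n i = x i"
proof (induction n arbitrary: i)
  case (Suc n)
  then have "\<exists>y\<in>K. (\<forall>j<n. y j = retract_prefix K x n j) \<and> y n = x n"
    by (intro bexI[of _ x]) auto
  with Suc show ?case by (auto simp: less_Suc_eq)
qed simp

lemma retract_prefix_cong: "(\<And>i. i < n \<Longrightarrow> x i = y i) \<Longrightarrow> retract_prefix K x n = retract_prefix K y n"
proof (induction n)
  case (Suc n)
  have "x n = y n" "retract_prefix K x n = retract_prefix K y n" using Suc by auto
  then show ?case by (simp only: retract_prefix.simps)
qed simp

lemma continuous_on_retract: "continuous_on UNIV (retract K)"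
proof (rule continuous_on_coordinatewise_then_product)
  fix n
  show "continuous_on UNIV (\<lambda>x. retract K x n)"
    unfolding continuous_on_discrete_iff
  proof (intro allI, subst open_subopen, intro ballI)
    fix v x assume x: "x \<in> {x. retract K x n = v}"
    have "retract K y n = retract K x n" if "y \<in> cylinder (Suc n) x" for y
      unfolding retract_def using retract_prefix_cong[of "Suc n" y x K] that by (simp add: cylinder_def)
    with x have "cylinder (Suc n) x \<subseteq> {x. retract K x n = v}" by blast
    moreover have "x \<in> cylinder (Suc n) x" by (simp add: cylinder_def)
    ultimately show "\<exists>T. open T \<and> x \<in> T \<and> T \<subseteq> {x. retract K x n = v}"
      using clopen_cylinder(1) by blast
  qed
qed

lemma range_retract:
  assumes "closed K" "K \<noteq> {}"
  shows "range (retract K) = K"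
proof
  show "K \<subseteq> range (retract K)"
  proof
    fix x assume "x \<in> K"
    then have "retract K x = x" unfolding retract_def by (intro ext retract_prefix_id) auto
    then show "x \<in> range (retract K)" by (metis rangeI)
  qed
  have "retract K x \<in> K" for x
  proof (rule ccontr)
    assume "retract K x \<notin> K"
    then obtain n where n: "cylinder n (retract K x) \<subseteq> - K"
      using cylinder_in_open[of "- K" "retract K x"] assms(1) by blast
    obtain y where "y \<in> K" "\<forall>i<n. y i = retract_prefix K x n i"
      using retract_prefix_in[OF assms(2)] by blast
    then have "y \<in> cylinder n (retract K x)" by (simp add: cylinder_def retract_prefix_eq)
    with n \<open>y \<in> K\<close> show False by blast
  qed
  then show "range (retract K) \<subseteq> K" by blast
qed

text \<open>Interleaving digits identifies the square of the Cantor space with the Cantor space itself,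
  where the retraction is available.\<close>

lemma compact_pairs_cantor_image:
  assumes K: "compact (K :: (cantor \<times> cantor) set)" "K \<noteq> {}"
  obtains p q where "continuous_on UNIV p" "continuous_on UNIV q" "K = range (\<lambda>x :: cantor. (p x, q x))"
proof -
  define merge :: "cantor \<times> cantor \<Rightarrow> cantor"
    where "merge z = (\<lambda>n. if even n then fst z (n div 2) else snd z (n div 2))" for z
  define l r :: "cantor \<Rightarrow> cantor" where "l x = (\<lambda>n. x (2 * n))" and "r x = (\<lambda>n. x (2 * n + 1))" for x
  have lr: "l (merge z) = fst z" "r (merge z) = snd z" for z
    by (simp_all add: l_def r_def merge_def)
  have "continuous_on UNIV (\<lambda>z :: cantor \<times> cantor. fst z k)"
    "continuous_on UNIV (\<lambda>z :: cantor \<times> cantor. snd z k)" for k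
    by (rule continuous_on_product_then_coordinatewise,
        rule continuous_on_fst continuous_on_snd, rule continuous_on_id)+
  then have "continuous_on UNIV (\<lambda>z. merge z n)" for n
    unfolding merge_def by (cases "even n") simp_all
  then have "continuous_on UNIV merge"
    by (rule continuous_on_coordinatewise_then_product)
  then have "continuous_on K merge"
    by (rule continuous_on_subset) simp
  then have "closed (merge ` K)"
    using K(1) by (intro closed_if_compact_cantor compact_continuous_image)
  then have range: "range (retract (merge ` K)) = merge ` K"
    using K(2) by (intro range_retract) auto
  show thesis
  proof
    have "continuous_on UNIV l" "continuous_on UNIV r"
      unfolding l_def r_def by (auto intro!: continuous_on_coordinatewise_then_product)
    then show "continuous_on UNIV (\<lambda>x. l (retract (merge ` K) x))" "continuous_on UNIV (\<lambda>x. r (retract (merge ` K) x))"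
      by (simp_all add: continuous_on_compose2[OF _ continuous_on_retract])
    have "range (\<lambda>x. (l (retract (merge ` K) x), r (retract (merge ` K) x)))
        = (\<lambda>y. (l y, r y)) ` range (retract (merge ` K))" by (simp add: image_image)
    also have "\<dots> = K" by (simp add: range image_image lr)
    finally show "K = range (\<lambda>x. (l (retract (merge ` K) x), r (retract (merge ` K) x)))" ..
  qed
qed

section \<open>Injective continuous bi-reducibility is analytic\<close>

text \<open>The code carries the two coordinate maps of the first relation at positions 0 and 1, those
  of the second at 2 and 3, and the two injective homomorphisms at 4 and 5.\<close>

lemma analytic_equiv_ic: "analytic_in (prod_topology S_m_topology S_m_topology) equiv_ic"
proof (rule analytic_in_gdelta_image)
  define K where "K b i = range (\<lambda>x. (coded_map b i x, coded_map b (Suc i) x))" for b i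
  define Col where "Col i = (\<Union>c\<in>{c :: cantor \<Rightarrow> nat. continuous_on UNIV c \<and> (\<forall>x. c x < 3)}.
      {b. \<forall>x\<in>UNIV. c (coded_map b i x) \<noteq> c (coded_map b (Suc i) x)})" for i
  define Inj where "Inj i = {b. inj (coded_map b i)}" for i
  define Hom where "Hom h i j = {b. \<forall>x. \<exists>y\<in>UNIV. coded_map b h (coded_map b i x) = coded_map b j y \<and>
      coded_map b h (coded_map b (Suc i) x) = coded_map b (Suc j) y}" for h i j
  let ?P = "(Col 0 \<inter> Col 2) \<inter> ((Inj 4 \<inter> Inj 5) \<inter> (Hom 4 0 2 \<inter> Hom 5 2 0))"
  let ?F = "\<lambda>b. ((UNIV, K b 0), (UNIV, K b 2)) :: (cantor set \<times> (cantor \<times> cantor) set) \<times> (cantor set \<times> (cantor \<times> cantor) set)"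
  have S_m: "(UNIV, K b i) \<in> S_m \<longleftrightarrow> b \<in> Col i" for b i
  proof -
    have "continuous_on UNIV (\<lambda>x. (coded_map b i x, coded_map b (Suc i) x))"
      by (intro continuous_on_Pair continuous_on_coded_map_section)
    then have "compact (K b i)" unfolding K_def using compact_cantor by (rule compact_continuous_image)
    then show ?thesis unfolding S_m_iff Col_def by (auto simp: K_def)
  qed
  have Hom: "b \<in> Hom h i j \<longleftrightarrow> K b i \<subseteq> map_prod (coded_map b h) (coded_map b h) -` K b j" for b h i j
    unfolding Hom_def K_def by (auto simp: image_iff subset_iff)
  have "open (Col i)" for i
  proof -
    have "open {b. \<forall>x\<in>UNIV. c (coded_map b i x) \<noteq> c (coded_map b (Suc i) x)}" if c: "continuous_on UNIV c"
      for c :: "cantor \<Rightarrow> nat"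
      by (intro open_Collect_ball_compact compact_cantor open_Collect_discrete2
          continuous_on_compose2[OF c continuous_on_coded_map_pair subset_UNIV])
    then show ?thesis unfolding Col_def by (intro open_UN) auto
  qed
  moreover have "gdelta_in euclidean (Inj i)" for i
  proof -
    \<comment> \<open>Injectivity is tested on the compact sets of pairs that differ at coordinate \<open>n\<close>.\<close>
    define D where "D n = {z :: cantor \<times> cantor. fst z n \<noteq> snd z n}" for n
    have coord: "continuous_on UNIV (\<lambda>z :: cantor \<times> cantor. fst z n)"
      "continuous_on UNIV (\<lambda>z :: cantor \<times> cantor. snd z n)" for n
      by (rule continuous_on_product_then_coordinatewise,
          rule continuous_on_fst continuous_on_snd, rule continuous_on_id)+
    have "compact (D n)" for n
    proof -
      have "open {z :: cantor \<times> cantor. fst z n = snd z n}"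
        by (rule open_Collect_discrete2[OF coord])
      moreover have "- D n = {z. fst z n = snd z n}" by (auto simp: D_def)
      ultimately have "closed (D n)" by (simp only: closed_def)
      then show ?thesis
        using compact_Int_closed[OF compact_Times[OF compact_cantor compact_cantor], of "D n"] by simp
    qed
    moreover have "open {w. coded_map (fst w) i (fst (snd w)) \<noteq> coded_map (fst w) i (snd (snd w))}"
    proof -
      have "closed {w :: (nat \<Rightarrow> nat) \<times> cantor \<times> cantor. coded_map (fst w) i (fst (snd w)) = coded_map (fst w) i (snd (snd w))}"
        by (intro closed_Collect_eq_cantor continuous_on_coded_map continuous_on_fst continuous_on_snd continuous_on_id)
      then show ?thesis by (simp only: closed_def Collect_neg_eq)
    qed
    ultimately have "open {b. \<forall>z\<in>D n. coded_map b i (fst z) \<noteq> coded_map b i (snd z)}" for n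
      by (rule open_Collect_ball_compact)
    then have "gdelta_in euclidean (\<Inter>n. {b. \<forall>z\<in>D n. coded_map b i (fst z) \<noteq> coded_map b i (snd z)})"
      by (intro gdelta_in_Inter) (auto intro: gdelta_open)
    moreover have "Inj i = (\<Inter>n. {b. \<forall>z\<in>D n. coded_map b i (fst z) \<noteq> coded_map b i (snd z)})"
      unfolding Inj_def D_def inj_def fun_eq_iff[of "_ :: cantor"] by auto
    ultimately show ?thesis by simp
  qed
  moreover have "closed (Hom h i j)" for h i j
    unfolding Hom_def
    by (intro closed_Collect_all closed_Collect_bex_compact compact_cantor closed_Collect_conj closed_Collect_eq_cantor
       continuous_on_coded_map continuous_on_fst continuous_on_snd continuous_on_const continuous_on_id)
  ultimately show "gdelta_in euclidean ?P"
    by (simp add: gdelta_in_Int gdelta_open gdelta_closed)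
  show "continuous_map (top_of_set ?P) (prod_topology S_m_topology S_m_topology) ?F"
  proof -
    have "continuous_map (top_of_set ?P) vietoris_topology (\<lambda>b. K b i)" for i
      unfolding K_def
      by (intro continuous_map_vietoris_topology_range compact_cantor continuous_map_codes
          continuous_on_Pair continuous_on_coded_map_pair)
    then show ?thesis
      unfolding continuous_map_pairwise comp_def fst_conv snd_conv
      by (intro conjI continuous_map_S_m) (auto simp: S_m)
  qed
  show "?F ` ?P = equiv_ic"
  proof
    show "?F ` ?P \<subseteq> equiv_ic"
    proof (rule image_subsetI)
      fix b assume b: "b \<in> ?P"
      have "(UNIV, K b i) \<preceq>ic (UNIV, K b j)" if "b \<in> Inj h" "b \<in> Hom h i j" for h i j
        using that unfolding inj_cont_le_def Hom by (auto simp: Inj_def intro!: exI[of _ "coded_map b h"] continuous_on_coded_map_section)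
      with b show "?F b \<in> equiv_ic" by (auto simp: equiv_ic_def S_m)
    qed
    show "equiv_ic \<subseteq> ?F ` ?P"
    proof clarify
      fix X Y :: "cantor set" and G H :: "(cantor \<times> cantor) set"
      assume GH: "((X, G), (Y, H)) \<in> equiv_ic"
      then have SG: "(X, G) \<in> S_m" and SH: "(Y, H) \<in> S_m" and le: "(X, G) \<preceq>ic (Y, H)" "(Y, H) \<preceq>ic (X, G)"
        by (auto simp: equiv_ic_def)
      have XY: "X = UNIV" "Y = UNIV" and "compact G" "G \<noteq> {}" "compact H" "H \<noteq> {}"
        using SG SH unfolding S_m_iff by blast+
      obtain p q where pq: "continuous_on UNIV p" "continuous_on UNIV q" "G = range (\<lambda>x :: cantor. (p x, q x))"
        by (rule compact_pairs_cantor_image[OF \<open>compact G\<close> \<open>G \<noteq> {}\<close>])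
      obtain r s where rs: "continuous_on UNIV r" "continuous_on UNIV s" "H = range (\<lambda>x :: cantor. (r x, s x))"
        by (rule compact_pairs_cantor_image[OF \<open>compact H\<close> \<open>H \<noteq> {}\<close>])
      obtain \<phi> where \<phi>: "continuous_on UNIV \<phi>" "inj \<phi>" "G \<subseteq> map_prod \<phi> \<phi> -` H"
        using le(1) unfolding inj_cont_le_def XY by auto
      obtain \<psi> where \<psi>: "continuous_on UNIV \<psi>" "inj \<psi>" "H \<subseteq> map_prod \<psi> \<psi> -` G"
        using le(2) unfolding inj_cont_le_def XY by auto
      define C where "C i = (if i = 0 then p else if i = 1 then q else if i = 2 then r
        else if i = 3 then s else if i = 4 then \<phi> else \<psi>)" for i :: nat
      have "continuous_on UNIV (C i)" for i
        using pq rs \<phi> \<psi> by (simp add: C_def)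
      then obtain b where b: "coded_map b = C" using coded_map_universal[of C] by blast
      have K: "K b 0 = G" "K b 2 = H"
        by (simp_all add: K_def b C_def pq rs)
      have "b \<in> ?P"
        using S_m[of b 0] S_m[of b 2] SG SH \<phi> \<psi> by (auto simp: K XY Hom Inj_def b C_def)
      then show "((X, G), (Y, H)) \<in> ?F ` ?P"
        by (rule rev_image_eqI) (simp add: K XY)
    qed
  qed
qed

section \<open>Minimality\<close>

lemma minimal_invariant_closed:
  assumes f: "f \<in> minimal_homeos" and A: "closed A" "x \<in> A" and inv: "\<And>y. f y \<in> A \<longleftrightarrow> y \<in> A"
  shows "A = UNIV"
proof -
  have "surj f" using minimal_homeosD(1)[OF f] homeosD(4) bij_is_surj by blast
  then have inv': "inv f y \<in> A \<longleftrightarrow> y \<in> A" for y using inv[of "inv f y"] by (simp add: surj_f_inv_f)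
  have "(f ^^ n) x \<in> A" "(inv f ^^ n) x \<in> A" for n
    using \<open>x \<in> A\<close> by (induction n) (simp_all add: inv inv')
  then have "{int_iterate f i x | i. True} \<subseteq> A" by (auto simp: int_iterate_def)
  then have "closure {int_iterate f i x | i. True} \<subseteq> A" using A(1) by (rule closure_minimal)
  then show ?thesis unfolding minimal_homeosD(2)[OF f] by blast
qed

text \<open>The orbit of a point of period at most two is a finite, hence closed, invariant set, whereas the
  Cantor space is infinite.\<close>

lemma minimal_no_period_two:
  assumes f: "f \<in> minimal_homeos"
  shows "f (f x) \<noteq> x"
proof
  assume period: "f (f x) = x"
  have "inj f" using minimal_homeosD(1)[OF f] homeosD(4) bij_is_inj by blast
  have "closed {x, f x}" by (intro closed_if_compact_cantor finite_imp_compact) simp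
  moreover have "f y \<in> {x, f x} \<longleftrightarrow> y \<in> {x, f x}" for y
    using inj_eq[OF \<open>inj f\<close>, of y x] inj_eq[OF \<open>inj f\<close>, of y "f x"] period by auto
  ultimately have "{x, f x} = UNIV" by (intro minimal_invariant_closed[OF f]) auto
  then have "finite (UNIV :: cantor set)" by (metis finite.emptyI finite_insert)
  then show False by (simp add: finite_UNIV_fun)
qed

lemma minimal_no_fixed_point:
  assumes f: "f \<in> minimal_homeos"
  shows "f x \<noteq> x"
  using minimal_no_period_two[OF f, of x] by auto

section \<open>Continuous three-colourings\<close>

text \<open>The greedy step: the points of the last colour form an independent set, so all of them can be
  recoloured at once, each with one of the colours 0, 1, 2 that avoids its two neighbours.\<close>

lemma colour_reduction:
  fixes c :: "cantor \<Rightarrow> nat"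
  assumes f: "f \<in> homeos"
    and c: "continuous_on UNIV c" "\<And>x. c x < 3 + n" "\<And>x. c x \<noteq> c (f x)"
  shows "\<exists>c' :: cantor \<Rightarrow> nat. continuous_on UNIV c' \<and> (\<forall>x. c' x < 3) \<and> (\<forall>x. c' x \<noteq> c' (f x))"
  using c
proof (induction n arbitrary: c)
  case 0
  then show ?case by (intro exI[of _ c]) simp
next
  case (Suc n)
  \<comment> \<open>A colour among 0, 1, 2 that differs from both arguments.\<close>
  define m :: "nat \<Rightarrow> nat \<Rightarrow> nat" where
    "m a b = (if a \<noteq> 0 \<and> b \<noteq> 0 then 0 else if a \<noteq> 1 \<and> b \<noteq> 1 then 1 else 2)" for a b
  have m: "m a b \<noteq> a" "m a b \<noteq> b" "m a b < 3" for a b by (auto simp: m_def)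
  define c' where "c' x = (if c x = 3 + n then m (c (f x)) (c (inv f x)) else c x)" for x
  have cf: "continuous_on UNIV (\<lambda>x. c (f x))" "continuous_on UNIV (\<lambda>x. c (inv f x))"
    using continuous_on_compose2[OF Suc.prems(1) _ subset_UNIV] homeosD(1,2)[OF f] by auto
  have "continuous_on UNIV (\<lambda>x. m (c (f x)) (c (inv f x)))"
    by (rule continuous_on_discrete2[OF cf])
  from continuous_on_discrete2[OF Suc.prems(1) this, of "\<lambda>a b. if a = 3 + n then b else a"]
  have "continuous_on UNIV c'" unfolding c'_def .
  moreover have "c' x < 3 + n" for x
    using m(3)[of "c (f x)" "c (inv f x)"] Suc.prems(2)[of x] by (auto simp: c'_def)
  moreover have "c' x \<noteq> c' (f x)" for x
  proof -
    have "inv f (f x) = x" using homeosD(4)[OF f] by (simp add: bij_is_inj)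
    then show ?thesis
      using Suc.prems(3)[of x] m(1)[of "c (f x)" "c (inv f x)"] m(2)[of "c (f (f x))" "c x"]
      by (auto simp: c'_def)
  qed
  ultimately show ?case by (rule Suc.IH)
qed

text \<open>By compactness there is a finite set \<open>I\<close> of coordinates such that \<open>x\<close> and \<open>f x\<close> always differ
  on \<open>I\<close>. The restriction of \<open>x\<close> to \<open>I\<close>, encoded as a number, is a finite colouring.\<close>

lemma three_colouring:
  assumes f: "f \<in> homeos" "\<And>x. f x \<noteq> x"
  shows "\<exists>c :: cantor \<Rightarrow> nat. continuous_on UNIV c \<and> (\<forall>x. c x < 3) \<and> (\<forall>x. c x \<noteq> c (f x))"
proof -
  define D where "D i = {x. x i \<noteq> f x i}" for i
  have coord: "continuous_on UNIV (\<lambda>x :: cantor. x i)" "continuous_on UNIV (\<lambda>x. f x i)" for i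
    using continuous_on_product_then_coordinatewise[OF homeosD(1)[OF f(1)]] by simp_all
  have D: "open (D i)" for i
    unfolding D_def by (rule open_Collect_discrete2[OF coord])
  have "UNIV \<subseteq> (\<Union>i\<in>UNIV. D i)" using f(2) by (auto simp: D_def fun_eq_iff)
  then obtain I where I: "finite I" "UNIV \<subseteq> (\<Union>i\<in>I. D i)"
    using compactE_image[OF compact_cantor, of UNIV D] D by metis
  define c where "c x = set_encode {i \<in> I. x i}" for x :: cantor
  have c: "c x = (\<Sum>i\<in>I. if x i then 2 ^ i else 0)" for x
    unfolding c_def set_encode_def using I(1) by (simp add: sum.inter_filter)
  have "continuous_on UNIV (\<lambda>x :: cantor. if x i then 2 ^ i else 0 :: nat)" for i
    using continuous_on_discrete2[OF coord(1) coord(1), of "\<lambda>a _. if a then 2 ^ i else 0" i i] .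
  then have "continuous_on UNIV c" unfolding c by (rule continuous_on_sum)
  moreover have "c x < 3 + (\<Sum>i\<in>I. 2 ^ i)" for x
  proof -
    have "c x \<le> (\<Sum>i\<in>I. 2 ^ i)" unfolding c by (intro sum_mono) simp
    then show ?thesis by simp
  qed
  moreover have "c x \<noteq> c (f x)" for x
  proof
    assume "c x = c (f x)"
    then have "{i \<in> I. x i} = {i \<in> I. f x i}"
      unfolding c_def using I(1) by (simp add: set_encode_eq)
    then show False using I(2) by (auto simp: D_def)
  qed
  ultimately show ?thesis by (rule colour_reduction[OF f(1)])
qed

section \<open>The reduction\<close>

text \<open>Written as the range of a map on a compact space, which yields compactness and continuous
  dependence on \<open>f\<close> at once; the Boolean selects the direction of the edge.\<close>

definition orbit_graph :: "(cantor \<Rightarrow> cantor) \<Rightarrow> (cantor \<times> cantor) set" where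
  "orbit_graph f = range (\<lambda>(s, x). if s then (x, f x) else (f x, x))"

lemma mem_orbit_graph: "(x, y) \<in> orbit_graph f \<longleftrightarrow> y = f x \<or> x = f y"
proof
  assume "y = f x \<or> x = f y"
  then have "(x, y) = (\<lambda>(s, x). if s then (x, f x) else (f x, x)) (if y = f x then (True, x) else (False, y))"
    by auto
  then show "(x, y) \<in> orbit_graph f" unfolding orbit_graph_def by (rule range_eqI)
qed (auto simp: orbit_graph_def split: if_splits)

lemma orbit_graph_subset_vimage:
  "orbit_graph f \<subseteq> map_prod \<phi> \<phi> -` orbit_graph g \<longleftrightarrow>
    (\<forall>x. \<phi> (f x) = g (\<phi> x) \<or> \<phi> x = g (\<phi> (f x)))"
proof
  assume *: "orbit_graph f \<subseteq> map_prod \<phi> \<phi> -` orbit_graph g"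
  show "\<forall>x. \<phi> (f x) = g (\<phi> x) \<or> \<phi> x = g (\<phi> (f x))"
  proof
    fix x
    have "(x, f x) \<in> orbit_graph f" by (simp add: mem_orbit_graph)
    with * have "map_prod \<phi> \<phi> (x, f x) \<in> orbit_graph g" by blast
    then show "\<phi> (f x) = g (\<phi> x) \<or> \<phi> x = g (\<phi> (f x))" by (simp add: mem_orbit_graph)
  qed
qed (auto simp: mem_orbit_graph)

text \<open>The parametrisation of the graph is glued from two maps on the clopen pieces where the Boolean is
  \<open>True\<close> and \<open>False\<close>, each continuous because evaluation is.\<close>

lemma continuous_map_orbit_graph: "continuous_map minimal_topology vietoris_topology orbit_graph"
proof -
  define h where "h f = (\<lambda>(s, x). if s then (x, f x) else (f x, x))" for f :: "cantor \<Rightarrow> cantor"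
  let ?E = "prod_topology minimal_topology (euclidean :: (bool \<times> cantor) topology)"
  have "continuous_map ?E euclidean (fst \<circ> snd)"
    by (rule continuous_map_compose[OF continuous_map_snd])
      (simp add: continuous_on_fst[OF continuous_on_id])
  moreover have "continuous_map ?E euclidean (snd \<circ> snd)"
    by (rule continuous_map_compose[OF continuous_map_snd])
      (simp add: continuous_on_snd[OF continuous_on_id])
  ultimately have pr: "continuous_map ?E euclidean (\<lambda>w. fst (snd w))"
    "continuous_map ?E euclidean (\<lambda>w. snd (snd w))"
    by (simp_all only: comp_def)
  have "continuous_map ?E homeo_topology fst"
    using continuous_map_fst[of minimal_topology] unfolding minimal_topology_def continuous_map_in_subtopology by blast
  then have "continuous_map ?E (prod_topology homeo_topology euclidean) (\<lambda>w. (fst w, snd (snd w)))"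
    using pr(2) by (simp add: continuous_map_pairwise comp_def)
  from continuous_map_compose[OF this continuous_map_evaluation]
  have ev: "continuous_map ?E euclidean (\<lambda>w. (fst w) (snd (snd w)))" by (simp add: comp_def)
  have pairs: "continuous_map ?E euclidean (\<lambda>w. (snd (snd w), (fst w) (snd (snd w))))"
    "continuous_map ?E euclidean (\<lambda>w. ((fst w) (snd (snd w)), snd (snd w)))"
    using ev pr(2) by (simp_all add: continuous_map_pairwise comp_def flip: prod_topology_euclidean)
  have "continuous_map ?E euclidean (\<lambda>w. h (fst w) (snd w))"
    unfolding continuous_map_def
  proof (intro conjI allI impI)
    fix W :: "(cantor \<times> cantor) set" assume W: "openin euclidean W"
    have "{w \<in> topspace ?E. h (fst w) (snd w) \<in> W}
      = ({w \<in> topspace ?E. fst (snd w) \<in> {True}} \<inter> {w \<in> topspace ?E. (snd (snd w), (fst w) (snd (snd w))) \<in> W})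
      \<union> ({w \<in> topspace ?E. fst (snd w) \<in> {False}} \<inter> {w \<in> topspace ?E. ((fst w) (snd (snd w)), snd (snd w)) \<in> W})"
      by (auto simp: h_def split: if_splits)
    also have "openin ?E \<dots>"
      by (intro openin_Un openin_Int openin_continuous_map_preimage[OF pr(1)]
          openin_continuous_map_preimage[OF pairs(1) W] openin_continuous_map_preimage[OF pairs(2) W])
        (simp_all add: open_discrete)
    finally show "openin ?E {w \<in> topspace ?E. h (fst w) (snd w) \<in> W}" .
  qed simp
  moreover have "compact (UNIV :: (bool \<times> cantor) set)"
    using compact_Times[OF finite_imp_compact[of "UNIV :: bool set"] compact_cantor] by simp
  ultimately have "continuous_map minimal_topology vietoris_topology (\<lambda>f. range (h f))"
    by (intro continuous_map_vietoris_topology_range)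
  then show ?thesis unfolding h_def orbit_graph_def .
qed

lemma orbit_graph_in_S_m:
  assumes f: "f \<in> minimal_homeos"
  shows "(UNIV, orbit_graph f) \<in> S_m"
  unfolding S_m_iff
proof (intro conjI refl)
  show "compact (orbit_graph f)"
    using continuous_map_image_subset_topspace[OF continuous_map_orbit_graph] f by auto
  show "orbit_graph f \<noteq> {}" by (simp add: orbit_graph_def)
  obtain c :: "cantor \<Rightarrow> nat" where c: "continuous_on UNIV c" "\<forall>x. c x < 3" "\<forall>x. c x \<noteq> c (f x)"
    using three_colouring[OF minimal_homeosD(1)[OF f] minimal_no_fixed_point[OF f]] by blast
  have "c x \<noteq> c y" if "(x, y) \<in> orbit_graph f" for x y
    using that c(3)[rule_format, of x] c(3)[rule_format, of y] by (auto simp: mem_orbit_graph)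
  with c show "\<exists>c :: cantor \<Rightarrow> nat. continuous_on UNIV c \<and> (\<forall>x. c x < 3) \<and> (\<forall>(x, y)\<in>orbit_graph f. c x \<noteq> c y)"
    by (intro exI[of _ c]) auto
qed

lemma continuous_bij_homeo:
  assumes "continuous_on UNIV \<phi>" "bij \<phi>"
  shows "\<phi> \<in> homeos"
proof (rule homeosI(1))
  have "closed (inv \<phi> -` C)" if "closed C" for C
  proof -
    have "compact C" using compact_Int_closed[OF compact_cantor that] by simp
    then have "compact (\<phi> ` C)"
      using assms(1) by (intro compact_continuous_image) (auto intro: continuous_on_subset)
    then show ?thesis using assms(2) by (simp add: closed_if_compact_cantor bij_vimage_eq_inv_image bij_imp_bij_inv inv_inv_eq)
  qed
  then show "continuous_on UNIV (inv \<phi>)" by (simp add: continuous_on_closed_vimage)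
qed (use assms in \<open>auto simp: bij_is_inj bij_is_surj surj_f_inv_f\<close>)

text \<open>Let \<open>A\<close> be the closed set of points where \<open>\<phi>\<close> preserves the direction of the edge from \<open>x\<close> to
  \<open>f x\<close>. If the direction changed between \<open>x\<close> and \<open>f x\<close>, then \<open>\<phi>\<close> would take the same value at
  \<open>x\<close> and \<open>f (f x)\<close>. So \<open>A\<close> is invariant and minimality makes it empty or everything. Either way
  the range of \<open>\<phi>\<close> is a closed invariant set of \<open>g\<close>, and \<open>\<phi>\<close> is onto.\<close>

lemma injective_homomorphism_flip_conjugacy:
  assumes f: "f \<in> minimal_homeos" and g: "g \<in> minimal_homeos"
    and \<phi>: "continuous_on UNIV \<phi>" "inj \<phi>" and hom: "\<And>x. \<phi> (f x) = g (\<phi> x) \<or> \<phi> x = g (\<phi> (f x))"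
  shows "\<phi> \<in> homeos" "\<phi> \<circ> f = g \<circ> \<phi> \<or> \<phi> \<circ> f = inv g \<circ> \<phi>"
proof -
  have bf: "bij f" "continuous_on UNIV f" and bg: "bij g" "continuous_on UNIV g"
    using homeosD[OF minimal_homeosD(1)[OF f]] homeosD[OF minimal_homeosD(1)[OF g]] by auto
  have inj_g: "g x = g y \<longleftrightarrow> x = y" for x y using bg(1) by (simp add: bij_is_inj inj_eq)
  have inj_\<phi>: "\<phi> x = \<phi> y \<longleftrightarrow> x = y" for x y using \<phi>(2) by (simp add: inj_eq)
  define A where "A = {x. \<phi> (f x) = g (\<phi> x)}"
  have "closed A" unfolding A_def
    by (rule closed_Collect_eq_cantor) (rule continuous_on_compose2[OF \<phi>(1) bf(2) subset_UNIV]
        continuous_on_compose2[OF bg(2) \<phi>(1) subset_UNIV])+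
  have not_A: "x \<notin> A \<longleftrightarrow> \<phi> x = g (\<phi> (f x))" for x
  proof
    assume "x \<notin> A"
    then show "\<phi> x = g (\<phi> (f x))" using hom[of x] unfolding A_def by blast
  next
    assume "\<phi> x = g (\<phi> (f x))"
    then have "\<phi> (f x) \<noteq> g (\<phi> x)" using minimal_no_period_two[OF g, of "\<phi> x"] by metis
    then show "x \<notin> A" by (simp add: A_def)
  qed
  have step: "f x \<in> A \<longleftrightarrow> x \<in> A" for x
  proof
    assume "f x \<in> A"
    show "x \<in> A"
    proof (rule ccontr)
      assume "x \<notin> A"
      with \<open>f x \<in> A\<close> have "\<phi> (f (f x)) = \<phi> x" using not_A by (simp add: A_def)
      then show False using minimal_no_period_two[OF f, of x] by (simp add: inj_\<phi>)
    qed
  next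
    assume "x \<in> A"
    show "f x \<in> A"
    proof (rule ccontr)
      assume "f x \<notin> A"
      with \<open>x \<in> A\<close> have "g (\<phi> x) = g (\<phi> (f (f x)))" using not_A[of "f x"] by (simp add: A_def)
      then show False using minimal_no_period_two[OF f, of x] by (simp add: inj_\<phi> inj_g)
    qed
  qed
  have "A = UNIV \<or> A = {}"
    using minimal_invariant_closed[OF f \<open>closed A\<close> _ step] by blast
  then have cases: "(\<forall>x. \<phi> (f x) = g (\<phi> x)) \<or> (\<forall>x. g (\<phi> (f x)) = \<phi> x)"
  proof
    assume "A = UNIV"
    then show ?thesis by (auto simp: A_def)
  next
    assume "A = {}"
    then have "g (\<phi> (f x)) = \<phi> x" for x using not_A[of x] by simp
    then show ?thesis by blast
  qed
  have "closed (range \<phi>)"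
    using compact_continuous_image[OF \<phi>(1) compact_cantor] by (rule closed_if_compact_cantor)
  moreover have "g y \<in> range \<phi> \<longleftrightarrow> y \<in> range \<phi>" for y
  proof
    assume "g y \<in> range \<phi>"
    then obtain x where x: "g y = \<phi> x" by blast
    obtain x' where x': "x = f x'" using bf(1) by (metis bij_is_surj surjD)
    show "y \<in> range \<phi>"
      using cases
    proof
      assume "\<forall>x. \<phi> (f x) = g (\<phi> x)"
      with x x' have "g y = g (\<phi> x')" by simp
      then show ?thesis by (simp add: inj_g)
    next
      assume "\<forall>x. g (\<phi> (f x)) = \<phi> x"
      with x have "g y = g (\<phi> (f x))" by simp
      then show ?thesis by (simp add: inj_g)
    qed
  next
    assume "y \<in> range \<phi>"
    then obtain x where x: "y = \<phi> x" by blast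
    obtain x' where x': "x = f x'" using bf(1) by (metis bij_is_surj surjD)
    show "g y \<in> range \<phi>"
      using cases
    proof
      assume "\<forall>x. \<phi> (f x) = g (\<phi> x)"
      with x have "g y = \<phi> (f x)" by simp
      then show ?thesis by simp
    next
      assume "\<forall>x. g (\<phi> (f x)) = \<phi> x"
      with x x' have "g y = \<phi> x'" by simp
      then show ?thesis by simp
    qed
  qed
  ultimately have "range \<phi> = UNIV"
    by (intro minimal_invariant_closed[OF g, of _ "\<phi> undefined"]) auto
  then show "\<phi> \<in> homeos" using \<phi> by (intro continuous_bij_homeo) (simp_all add: bij_def)
  show "\<phi> \<circ> f = g \<circ> \<phi> \<or> \<phi> \<circ> f = inv g \<circ> \<phi>"
    using cases
  proof
    assume "\<forall>x. \<phi> (f x) = g (\<phi> x)"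
    then show ?thesis by (simp add: fun_eq_iff)
  next
    assume *: "\<forall>x. g (\<phi> (f x)) = \<phi> x"
    have "\<phi> (f x) = inv g (\<phi> x)" for x
      using inv_f_f[OF bij_is_inj[OF bg(1)], of "\<phi> (f x)"] * by simp
    then show ?thesis by (simp add: fun_eq_iff)
  qed
qed

text \<open>The reversed equation is stated without the inverse of \<open>g\<close>, in the form in which it arises
  from the edges of the two graphs.\<close>

lemma FCO_iff:
  assumes f: "f \<in> minimal_homeos" and g: "g \<in> minimal_homeos"
  shows "(f, g) \<in> FCO \<longleftrightarrow> (\<exists>\<phi>\<in>homeos. (\<forall>x. \<phi> (f x) = g (\<phi> x)) \<or> (\<forall>x. \<phi> x = g (\<phi> (f x))))"
proof -
  have "bij g" using homeosD(4)[OF minimal_homeosD(1)[OF g]] .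
  then have "y = inv g z \<longleftrightarrow> z = g y" for y z
    by (metis bij_inv_eq_iff)
  then show ?thesis using f g unfolding FCO_def by (simp add: fun_eq_iff)
qed

lemma FCO_sym:
  assumes "(f, g) \<in> FCO"
  shows "(g, f) \<in> FCO"
proof -
  have f: "f \<in> minimal_homeos" and g: "g \<in> minimal_homeos" using assms by (auto simp: FCO_def)
  obtain \<phi> where \<phi>: "\<phi> \<in> homeos" "(\<forall>x. \<phi> (f x) = g (\<phi> x)) \<or> (\<forall>x. \<phi> x = g (\<phi> (f x)))"
    using assms unfolding FCO_iff[OF f g] by blast
  have inv: "inv \<phi> (\<phi> x) = x" "\<phi> (inv \<phi> x) = x" for x
    using homeosD(4)[OF \<phi>(1)] by (simp_all add: bij_is_inj bij_is_surj surj_f_inv_f)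
  have "(\<forall>y. inv \<phi> (g y) = f (inv \<phi> y)) \<or> (\<forall>y. inv \<phi> y = f (inv \<phi> (g y)))"
    using \<phi>(2)
  proof
    assume *: "\<forall>x. \<phi> (f x) = g (\<phi> x)"
    have "inv \<phi> (g y) = f (inv \<phi> y)" for y
      using inv(1)[of "f (inv \<phi> y)"] by (simp add: * inv(2))
    then show ?thesis by blast
  next
    assume *: "\<forall>x. \<phi> x = g (\<phi> (f x))"
    have "inv \<phi> y = f (inv \<phi> (g y))" for y
    proof -
      have "g y = g (\<phi> (f (inv \<phi> (g y))))"
        using *[rule_format, of "inv \<phi> (g y)"] by (simp add: inv(2))
      then have "y = \<phi> (f (inv \<phi> (g y)))"
        using homeosD(4)[OF minimal_homeosD(1)[OF g]] by (simp add: bij_is_inj inj_eq)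
      then show ?thesis by (metis inv(1))
    qed
    then show ?thesis by blast
  qed
  then show ?thesis unfolding FCO_iff[OF g f] using homeosD(3)[OF \<phi>(1)] by blast
qed

text \<open>A single homomorphism already yields flip conjugacy, so on graphs of minimal homeomorphisms the
  quasi-order is symmetric.\<close>

lemma inj_cont_le_orbit_graph_iff:
  assumes f: "f \<in> minimal_homeos" and g: "g \<in> minimal_homeos"
  shows "(UNIV, orbit_graph f) \<preceq>ic (UNIV, orbit_graph g) \<longleftrightarrow> (f, g) \<in> FCO"
proof -
  have le: "(UNIV, orbit_graph f) \<preceq>ic (UNIV, orbit_graph g) \<longleftrightarrow>
    (\<exists>\<phi>. continuous_on UNIV \<phi> \<and> inj \<phi> \<and> (\<forall>x. \<phi> (f x) = g (\<phi> x) \<or> \<phi> x = g (\<phi> (f x))))"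
    by (simp add: inj_cont_le_def orbit_graph_subset_vimage)
  show ?thesis
  proof
    assume "(UNIV, orbit_graph f) \<preceq>ic (UNIV, orbit_graph g)"
    then obtain \<phi> where "continuous_on UNIV \<phi>" "inj \<phi>" "\<And>x. \<phi> (f x) = g (\<phi> x) \<or> \<phi> x = g (\<phi> (f x))"
      unfolding le by blast
    from injective_homomorphism_flip_conjugacy[OF f g this] show "(f, g) \<in> FCO"
      using f g unfolding FCO_def by blast
  next
    assume "(f, g) \<in> FCO"
    then obtain \<phi> where "\<phi> \<in> homeos" "(\<forall>x. \<phi> (f x) = g (\<phi> x)) \<or> (\<forall>x. \<phi> x = g (\<phi> (f x)))"
      unfolding FCO_iff[OF f g] by blast
    then show "(UNIV, orbit_graph f) \<preceq>ic (UNIV, orbit_graph g)"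
      unfolding le using homeosD(1,4) bij_is_inj by blast
  qed
qed

lemma continuous_map_imp_borel_map:
  assumes "continuous_map X Y f"
  shows "borel_map X Y f"
proof -
  have "{U. openin X U} \<subseteq> Pow (topspace X)" "{U. openin Y U} \<subseteq> Pow (topspace Y)"
    using openin_subset by blast+
  then show ?thesis
    unfolding borel_map_def borel_of_def
  proof (intro measurable_sigma_sets[OF sets_measure_of])
    show "f \<in> space (sigma (topspace X) {U. openin X U}) \<rightarrow> topspace Y"
      using continuous_map_image_subset_topspace[OF assms] \<open>{U. openin X U} \<subseteq> Pow (topspace X)\<close>
      by (auto simp: space_measure_of)
    fix V assume "V \<in> {U. openin Y U}"
    then have "openin X {x \<in> topspace X. f x \<in> V}"
      using openin_continuous_map_preimage[OF assms] by blast
    moreover have "f -` V \<inter> space (sigma (topspace X) {U. openin X U}) = {x \<in> topspace X. f x \<in> V}"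
      using \<open>{U. openin X U} \<subseteq> Pow (topspace X)\<close> by (auto simp: space_measure_of)
    ultimately show "f -` V \<inter> space (sigma (topspace X) {U. openin X U}) \<in> sets (sigma (topspace X) {U. openin X U})"
      using \<open>{U. openin X U} \<subseteq> Pow (topspace X)\<close> by (simp add: sets_measure_of)
  qed
qed

theorem theorem1p17:
  shows "analytic_in (prod_topology minimal_topology minimal_topology) FCO \<and>
    analytic_in (prod_topology minimal_topology minimal_topology) CO \<and>
    analytic_in (prod_topology S_m_topology S_m_topology) equiv_ic \<and>
    (\<exists>\<Phi>. borel_map minimal_topology S_m_topology \<Phi> \<and>
      FCO = {(f, g). f \<in> minimal_homeos \<and> g \<in> minimal_homeos \<and> (\<Phi> f, \<Phi> g) \<in> equiv_ic})"
proof (intro conjI analytic_FCO analytic_CO analytic_equiv_ic exI)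
  show "borel_map minimal_topology S_m_topology (\<lambda>f. (UNIV, orbit_graph f))"
    by (intro continuous_map_imp_borel_map continuous_map_S_m continuous_map_orbit_graph orbit_graph_in_S_m) simp
  have "(f, g) \<in> FCO \<longleftrightarrow> ((UNIV, orbit_graph f), (UNIV, orbit_graph g)) \<in> equiv_ic"
    if "f \<in> minimal_homeos" "g \<in> minimal_homeos" for f g
    using that FCO_sym[of f g]
    by (auto simp: equiv_ic_def orbit_graph_in_S_m inj_cont_le_orbit_graph_iff)
  moreover have "FCO \<subseteq> minimal_homeos \<times> minimal_homeos" by (auto simp: FCO_def)
  ultimately show "FCO = {(f, g). f \<in> minimal_homeos \<and> g \<in> minimal_homeos \<and>
      ((UNIV, orbit_graph f), (UNIV, orbit_graph g)) \<in> equiv_ic}"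
    by auto
qed

end
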